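(* Let $x_1,x_2,\dots$ be a sample of a stationary ergodic process $\{X_t\}_{t\in\mathbb{Z}}$ over a finite alphabet $A$, with context tree $\mathcal{T}_0$, satisfying $\alpha_0>0$ and $\alpha=\sum_{k\in\mathbb{N}}(1-\alpha_k)<+\infty$. Let $f$ be a penalizing term, let $d=d(n)<n$ be an integer-valued function growing to infinity with $n$, and let $\hat{\mathcal{T}}(x_1^n)$ be the penalized likelihood context tree estimator with penalizing term $f$ and maximal height $d$. For any constant $K\in\mathbb{N}$ there exist an integer $n_0$ and positive constants $c_1,c_2,c_3,c_4$ depending on the process such that for any $n\ge n_0$: (a) $\mathbb{P}[U_n^K]\le c_1\,e^{-c_2(n-d)}$; (b) $\mathbb{P}[O_n^K]\le c_3\,|A|^d\,e^{-c_4 f(n)(\alpha_0^2/|A|)^d/d}$, where $$U_n^K=\bigcup_{w\in \mathrm{Int}(\mathcal{T}_0|_K)}\{w\in\hat{\mathcal{T}}(x_1^n)\}$$ is the underestimation event and $$O_n^K=\bigcup_{w\succ v\in\mathcal{T}_0,\ \ell(v)<K}\{w\in\hat{\mathcal{T}}(x_1^n)\}$$ is the overestimation event.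
   Context: Sequences and trees. $A$ is a finite alphabet with $|A|$ symbols; $A^j$ is the set of sequences of length $j$ over $A$; $w_m^n=(w_m,\dots,w_n)$ has length $\ell(w_m^n)=n-m+1$; $\lambda$ is the empty string, of length $0$; $vw$ denotes concatenation ($v$ followed by $w$, where $v$ may be semi-infinite, $v=(\dots,v_{-2},v_{-1})=v_{-\infty}^{-1}$). Semi-infinite sequences have length $+\infty$. $s\prec w$ (equivalently $w\succ s$) means that $s$ is a suffix of $w$: there is $u$ with $\ell(u)\ge1$ and $w=us$; $s\preceq w$ means $s\prec w$ or $s=w$. A tree is a set $\mathcal{T}$ of finite or semi-infinite sequences such that no $s\in\mathcal{T}$ is a suffix of another $w\in\mathcal{T}$. Its height is $h(\mathcal{T})=\sup\{\ell(w):w\in\mathcal{T}\}$; if the height is finite, $|\mathcal{T}|$ is the number of sequences in $\mathcal{T}$. The truncation to level $K$ is $\mathcal{T}|_K=\{w\in\mathcal{T}:\ell(w)\le K\}\cup\{w:\ell(w)=K,\ w\prec u\text{ for some }u\in\mathcal{T}\}$, and $\mathrm{Int}(\mathcal{T})=\{w: w\prec u\text{ for some }u\in\mathcal{T}\}$. $\mathcal{T}$ is complete if every semi-infinite sequence $w_{-\infty}^{-1}$ over $A$ satisfies $s\preceq w_{-\infty}^{-1}$ for some $s\in\mathcal{T}$. Process and context tree. For $w\in A^j$, $p(w)=\mathbb{P}(X_1^j=w)$, and if $p(w)>0$, $p(a|w)=\mathbb{P}(X_0=a\mid X_{-j}^{-1}=w)$; for semi-infinite $w$, $p(a|w)=\mathbb{P}(X_0=a\mid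 X_{-\infty}^{-1}=w)$. A sequence $w\in A^j$ is a context if (1) for every semi-infinite $x_{-\infty}^{-1}$ having $w$ as a suffix, $\mathbb{P}(X_0=a\mid X_{-\infty}^{-1}=x_{-\infty}^{-1})=p(a|w)$ for all $a\in A$, and (2) no suffix of $w$ satisfies (1). An infinite context is a semi-infinite sequence none of whose finite suffixes $w_{-j}^{-1}$, $j=1,2,\dots$, is a context. The context tree $\mathcal{T}_0$ is the set of all finite and infinite contexts; for an i.i.d. process, $\mathcal{T}_0=\{\lambda\}$. Continuity quantities. $\alpha_0=\inf_{w\in\mathcal{T}_0,\,a\in A}p(a|w)$ and, for $k\ge1$, $\alpha_k=\inf_{u\in A^k}\sum_{a\in A}\inf_{w\in\mathcal{T}_0,\,w\succ u}p(a|w)$, where for a $u$ with no $w\in\mathcal{T}_0$, $w\succ u$, the sum over $a$ is read as $1$; $\mathbb{N}=\{0,1,2,\dots\}$ in $\alpha=\sum_{k\in\mathbb{N}}(1-\alpha_k)$. Estimator. Given the sample $x_1^n$, for a sequence $w$ with $\ell(w)\le d$ and $a\in A$, $N_n(w,a)=\sum_{t=d+1}^n\mathbf{1}\{x_{t-\ell(w)}^{t-1}=w,\ x_t=a\}$ and $N_n(w)=\sum_{a\in A}N_n(w,a)$. A tree $\mathcal{T}$ is feasible if it is complete, $h(\mathcal{T})\le d$, $N_n(w)\ge1$ for all $w\in\mathcal{T}$, and any string $w'$ with $N_n(w')\ge1$ either belongs to $\mathcal{T}$, is a suffix of some $w\in\mathcal{T}$, or has a suffix that belongs to $\mathcal{T}$;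 $\mathcal{F}^d(x_1^n)$ is the set of feasible trees. Set $\hat p_n(a|w)=N_n(w,a)/N_n(w)$ and, for $\mathcal{T}\in\mathcal{F}^d(x_1^n)$, $\hat{\mathbb{P}}_{\mathrm{ML},\mathcal{T}}(x_1^n)=\prod_{w\in\mathcal{T}}\prod_{a\in A}\hat p_n(a|w)^{N_n(w,a)}$, with $0^0=1$. A penalizing term is a positive function $f(n)$ with $f(n)\to+\infty$ and $f(n)/n\to0$ as $n\to+\infty$. The penalized likelihood context tree estimator is a tree $$\hat{\mathcal{T}}(x_1^n)=\underset{\mathcal{T}\in\mathcal{F}^d(x_1^n)}{\arg\min}\{-\log\hat{\mathbb{P}}_{\mathrm{ML},\mathcal{T}}(x_1^n)+|\mathcal{T}|f(n)\}.$$
   Formalization: Two assumptions are added because the claim fails without them: the alphabet has at least two symbols, and, for part (a) only, f(n)/(n-d(n)) tends to 0 (otherwise the penalty can dominate the likelihood and the root tree is always selected). *)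

theory Defs
  imports "HOL-Probability.Probability" "HOL-Library.Sublist"
begin

section \<open>Sequences and trees\<close>

text \<open>
  The alphabet is a finite type \<open>'a\<close>. A finite string is a list in chronological order, so its last
  entry is the most recent symbol. A semi-infinite sequence \<open>(..., x_{-2}, x_{-1})\<close> is a function
  on \<open>nat\<close> read backwards in time: \<open>x i\<close> stands for \<open>x_{-(i+1)}\<close>.
\<close>

datatype 'a word = Fin "'a list" | SemiInf "nat \<Rightarrow> 'a"

definition recent :: "(nat \<Rightarrow> 'a) \<Rightarrow> nat \<Rightarrow> 'a list"  \<comment> \<open>\<open>x_{-j}, ..., x_{-1}\<close>\<close>
  where "recent x j = rev (map x [0..<j])"

fun len :: "'a word \<Rightarrow> enat"
  where
    "len (Fin w) = enat (length w)"
  | "len (SemiInf x) = \<infinity>"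

text \<open>A proper suffix is always finite: a semi-infinite sequence cannot be extended to the left.\<close>

fun proper_suffix :: "'a word \<Rightarrow> 'a word \<Rightarrow> bool"  (infix \<open>\<prec>\<close> 50)
  where
    "Fin s \<prec> Fin w \<longleftrightarrow> strict_suffix s w"
  | "Fin s \<prec> SemiInf x \<longleftrightarrow> s = recent x (length s)"
  | "SemiInf y \<prec> w \<longleftrightarrow> False"

definition suffix_eq :: "'a word \<Rightarrow> 'a word \<Rightarrow> bool"  (infix \<open>\<preceq>\<close> 50)
  where "s \<preceq> w \<longleftrightarrow> s \<prec> w \<or> s = w"

definition is_tree :: "'a word set \<Rightarrow> bool"
  where "is_tree T \<longleftrightarrow> (\<forall>s\<in>T. \<forall>w\<in>T. \<not> s \<prec> w)"

definition height :: "'a word set \<Rightarrow> enat"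
  where "height T = (SUP w\<in>T. len w)"

definition truncation :: "'a word set \<Rightarrow> nat \<Rightarrow> 'a word set"
  where "truncation T K =
    {w \<in> T. len w \<le> enat K} \<union> {w. len w = enat K \<and> (\<exists>u\<in>T. w \<prec> u)}"

definition Int_tree :: "'a word set \<Rightarrow> 'a word set"
  where "Int_tree T = {w. \<exists>u\<in>T. w \<prec> u}"

definition complete_tree :: "'a word set \<Rightarrow> bool"
  where "complete_tree T \<longleftrightarrow> (\<forall>x. \<exists>s\<in>T. s \<preceq> SemiInf x)"

section \<open>The process and its context tree\<close>

abbreviation path_space :: "'i itself \<Rightarrow> ('i \<Rightarrow> 'a) measure"
  where "path_space _ \<equiv> (\<Pi>\<^sub>M i\<in>(UNIV :: 'i set). count_space (UNIV :: 'a set))"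

definition block :: "(int \<Rightarrow> 'b \<Rightarrow> 'a) \<Rightarrow> int \<Rightarrow> int \<Rightarrow> 'b \<Rightarrow> 'a list"
  where "block X m n \<omega> = map (\<lambda>t. X t \<omega>) [m..n]"

definition past :: "(int \<Rightarrow> 'b \<Rightarrow> 'a) \<Rightarrow> 'b \<Rightarrow> nat \<Rightarrow> 'a"
  where "past X \<omega> = (\<lambda>i. X (- int i - 1) \<omega>)"

definition stationary :: "'b measure \<Rightarrow> (int \<Rightarrow> 'b \<Rightarrow> 'a) \<Rightarrow> bool"
  where "stationary M X \<longleftrightarrow>
    distr M (path_space TYPE(int)) (\<lambda>\<omega> t. X (t + 1) \<omega>) = distr M (path_space TYPE(int)) (\<lambda>\<omega> t. X t \<omega>)"

definition ergodic :: "'b measure \<Rightarrow> (int \<Rightarrow> 'b \<Rightarrow> 'a) \<Rightarrow> bool"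
  where "ergodic M X \<longleftrightarrow>
    (\<forall>B \<in> sets (path_space TYPE(int)). (\<lambda>x t. x (t + 1)) -` B = B \<longrightarrow>
       measure M {\<omega> \<in> space M. (\<lambda>t. X t \<omega>) \<in> B} \<in> {0, 1})"

definition stationary_ergodic_process :: "'b measure \<Rightarrow> (int \<Rightarrow> 'b \<Rightarrow> 'a) \<Rightarrow> bool"
  where "stationary_ergodic_process M X \<longleftrightarrow>
    prob_space M \<and> (\<forall>t. X t \<in> measurable M (count_space UNIV)) \<and> stationary M X \<and> ergodic M X"

text \<open>
  Conditional probabilities given the whole past are determined only almost surely, whereas the
  context tree and the continuity quantities refer to their values at individual pasts. So a version
  \<open>q\<close>, with \<open>q x a\<close> the probability of symbol \<open>a\<close> after the past \<open>x\<close>, is part of the data.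
\<close>

definition past_version ::
    "'b measure \<Rightarrow> (int \<Rightarrow> 'b \<Rightarrow> 'a::finite) \<Rightarrow> ((nat \<Rightarrow> 'a) \<Rightarrow> 'a \<Rightarrow> real) \<Rightarrow> bool"
  where "past_version M X q \<longleftrightarrow>
    (\<forall>x a. 0 \<le> q x a) \<and> (\<forall>x. (\<Sum>a\<in>UNIV. q x a) = 1) \<and>
    (\<forall>a. (\<lambda>x. q x a) \<in> borel_measurable (path_space TYPE(nat))) \<and>
    (\<forall>a. AE \<omega> in M.
       real_cond_exp M (vimage_algebra (space M) (past X) (path_space TYPE(nat)))
         (indicator {\<omega>' \<in> space M. X 0 \<omega>' = a}) \<omega> = q (past X \<omega>) a)"

definition word_prob :: "'b measure \<Rightarrow> (int \<Rightarrow> 'b \<Rightarrow> 'a) \<Rightarrow> 'a list \<Rightarrow> real"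
  where "word_prob M X w = measure M {\<omega> \<in> space M. block X 1 (int (length w)) \<omega> = w}"

fun trans_prob ::
    "'b measure \<Rightarrow> (int \<Rightarrow> 'b \<Rightarrow> 'a) \<Rightarrow> ((nat \<Rightarrow> 'a) \<Rightarrow> 'a \<Rightarrow> real) \<Rightarrow> 'a word \<Rightarrow> 'a \<Rightarrow> real"
  where
    "trans_prob M X q (Fin w) a =
       \<P>(\<omega> in M. X 0 \<omega> = a \<bar> block X (- int (length w)) (-1) \<omega> = w)"
  | "trans_prob M X q (SemiInf x) a = q x a"

text \<open>Positive probability of \<open>w\<close> is required because \<open>p(a|w)\<close> is undefined otherwise.\<close>

definition determines_next ::
    "'b measure \<Rightarrow> (int \<Rightarrow> 'b \<Rightarrow> 'a) \<Rightarrow> ((nat \<Rightarrow> 'a) \<Rightarrow> 'a \<Rightarrow> real) \<Rightarrow> 'a list \<Rightarrow> bool"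
  where "determines_next M X q w \<longleftrightarrow> word_prob M X w > 0 \<and>
    (\<forall>x. Fin w \<prec> SemiInf x \<longrightarrow>
       (\<forall>a. trans_prob M X q (SemiInf x) a = trans_prob M X q (Fin w) a))"

definition is_context ::
    "'b measure \<Rightarrow> (int \<Rightarrow> 'b \<Rightarrow> 'a) \<Rightarrow> ((nat \<Rightarrow> 'a) \<Rightarrow> 'a \<Rightarrow> real) \<Rightarrow> 'a list \<Rightarrow> bool"
  where "is_context M X q w \<longleftrightarrow> determines_next M X q w \<and>
    (\<forall>s. Fin s \<prec> Fin w \<longrightarrow> \<not> determines_next M X q s)"

text \<open>
  The empty string counts among the finite suffixes of a semi-infinite sequence, so that an i.i.d.
  process has context tree \<open>{Fin []}\<close>.
\<close>

definition infinite_context ::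
    "'b measure \<Rightarrow> (int \<Rightarrow> 'b \<Rightarrow> 'a) \<Rightarrow> ((nat \<Rightarrow> 'a) \<Rightarrow> 'a \<Rightarrow> real) \<Rightarrow> (nat \<Rightarrow> 'a) \<Rightarrow> bool"
  where "infinite_context M X q x \<longleftrightarrow> (\<forall>s. Fin s \<prec> SemiInf x \<longrightarrow> \<not> is_context M X q s)"

definition context_tree ::
    "'b measure \<Rightarrow> (int \<Rightarrow> 'b \<Rightarrow> 'a) \<Rightarrow> ((nat \<Rightarrow> 'a) \<Rightarrow> 'a \<Rightarrow> real) \<Rightarrow> 'a word set"
  where "context_tree M X q =
    {Fin w |w. is_context M X q w} \<union> {SemiInf x |x. infinite_context M X q x}"

definition alpha ::
    "'b measure \<Rightarrow> (int \<Rightarrow> 'b \<Rightarrow> 'a::finite) \<Rightarrow> ((nat \<Rightarrow> 'a) \<Rightarrow> 'a \<Rightarrow> real) \<Rightarrow> nat \<Rightarrow> real"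
  where "alpha M X q k =
    (let T0 = context_tree M X q; p = trans_prob M X q in
     if k = 0 then (INF (w, a) \<in> T0 \<times> UNIV. p w a)
     else (INF u \<in> {u. length u = k}.
       if \<exists>w\<in>T0. Fin u \<prec> w then (\<Sum>a\<in>UNIV. INF w \<in> {w\<in>T0. Fin u \<prec> w}. p w a) else 1))"

section \<open>The penalized likelihood estimator\<close>

text \<open>
  A sample \<open>x_1, ..., x_n\<close> is a list of length \<open>n\<close>. Times are numbered from 1, list positions from 0.
  Trees of bounded height consist of finite strings and are represented as sets of lists.
\<close>

definition obs :: "'a list \<Rightarrow> nat \<Rightarrow> 'a"
  where "obs xs t = xs ! (t - 1)"

definition segment :: "'a list \<Rightarrow> nat \<Rightarrow> nat \<Rightarrow> 'a list"
  where "segment xs i j = map (obs xs) [i..<Suc j]"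

definition count_next :: "nat \<Rightarrow> 'a list \<Rightarrow> 'a list \<Rightarrow> 'a \<Rightarrow> nat"  \<comment> \<open>meaningful for \<open>length w \<le> d\<close>\<close>
  where "count_next d xs w a =
    (\<Sum>t = d + 1..length xs. if segment xs (t - length w) (t - 1) = w \<and> obs xs t = a then 1 else 0)"

definition count_word :: "nat \<Rightarrow> 'a::finite list \<Rightarrow> 'a list \<Rightarrow> nat"
  where "count_word d xs w = (\<Sum>a\<in>UNIV. count_next d xs w a)"

definition feasible :: "nat \<Rightarrow> 'a::finite list \<Rightarrow> 'a list set \<Rightarrow> bool"
  where "feasible d xs T \<longleftrightarrow>
    is_tree (Fin ` T) \<and> complete_tree (Fin ` T) \<and> height (Fin ` T) \<le> enat d \<and>
    (\<forall>w\<in>T. count_word d xs w \<ge> 1) \<and>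
    (\<forall>w'. length w' \<le> d \<and> count_word d xs w' \<ge> 1 \<longrightarrow>
       w' \<in> T \<or> (\<exists>w\<in>T. Fin w' \<prec> Fin w) \<or> (\<exists>s\<in>T. Fin s \<prec> Fin w'))"

definition p_hat :: "nat \<Rightarrow> 'a::finite list \<Rightarrow> 'a list \<Rightarrow> 'a \<Rightarrow> real"
  where "p_hat d xs w a = real (count_next d xs w a) / real (count_word d xs w)"

definition max_likelihood :: "nat \<Rightarrow> 'a::finite list \<Rightarrow> 'a list set \<Rightarrow> real"
  where "max_likelihood d xs T = (\<Prod>w\<in>T. \<Prod>a\<in>UNIV. p_hat d xs w a ^ count_next d xs w a)"

definition penalizing_term :: "(nat \<Rightarrow> real) \<Rightarrow> bool"
  where "penalizing_term f \<longleftrightarrow>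
    (\<forall>n. f n > 0) \<and> filterlim f at_top sequentially \<and> (\<lambda>n. f n / real n) \<longlonglongrightarrow> 0"

text \<open>
  The minimizer need not be unique; an estimator is any function of the sample selecting one.
\<close>

definition penalized_likelihood_estimator ::
    "(nat \<Rightarrow> real) \<Rightarrow> (nat \<Rightarrow> nat) \<Rightarrow> ('a::finite list \<Rightarrow> 'a list set) \<Rightarrow> bool"
  where "penalized_likelihood_estimator f d That \<longleftrightarrow>
    (\<forall>xs. xs \<noteq> [] \<longrightarrow>
       is_arg_min
         (\<lambda>T. - ln (max_likelihood (d (length xs)) xs T) + real (card T) * f (length xs))
         (feasible (d (length xs)) xs)
         (That xs))"

definition underestimation ::
    "'b measure \<Rightarrow> (int \<Rightarrow> 'b \<Rightarrow> 'a) \<Rightarrow> ((nat \<Rightarrow> 'a) \<Rightarrow> 'a \<Rightarrow> real) \<Rightarrow>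
     ('a list \<Rightarrow> 'a list set) \<Rightarrow> nat \<Rightarrow> nat \<Rightarrow> 'b set"
  where "underestimation M X q That K n =
    (\<Union>w \<in> {w. Fin w \<in> Int_tree (truncation (context_tree M X q) K)}.
       {\<omega> \<in> space M. w \<in> That (block X 1 (int n) \<omega>)})"

definition overestimation ::
    "'b measure \<Rightarrow> (int \<Rightarrow> 'b \<Rightarrow> 'a) \<Rightarrow> ((nat \<Rightarrow> 'a) \<Rightarrow> 'a \<Rightarrow> real) \<Rightarrow>
     ('a list \<Rightarrow> 'a list set) \<Rightarrow> nat \<Rightarrow> nat \<Rightarrow> 'b set"
  where "overestimation M X q That K n =
    (\<Union>w \<in> {w. \<exists>v \<in> context_tree M X q. v \<prec> Fin w \<and> len v < enat K}.
       {\<omega> \<in> space M. w \<in> That (block X 1 (int n) \<omega>)})"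

end

theory Submission
  imports Defs
begin

text \<open>
  Two facts about the process carry the proof. First, \<open>\<alpha>\<^sub>0\<close> bounds every conditional probability
  \<open>q x a\<close> from below. Second, the conditional probabilities are uniformly continuous in the past: if
  two pasts share their last \<open>k\<close> symbols, their values of \<open>q\<close> differ by at most \<open>\<bar>1 - \<alpha>\<^sub>k\<bar>\<close>
  (\<open>q_diff_le\<close>), and summability sends this to \<open>0\<close>. Bounds on \<open>q\<close> over all pasts ending in a word
  \<open>w\<close> become bounds on \<open>\<mu> (w a) / \<mu> w\<close> for the word probabilities \<open>\<mu>\<close> (\<open>word_prob_snoc_bounds\<close>).
  Everything about the sample is then a finite computation with \<open>\<mu>\<close>, and needs two estimates, with
  \<open>m = n - d\<close> the number of times that are counted:

  \<^item> \<open>pr_count_word_small\<close>: a word of length \<open>k\<close> occurs more than \<open>m \<alpha>\<^sub>0^k / (4 k)\<close> times, except with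
    exponentially small probability. In disjoint windows of length \<open>k\<close>, whatever the past, the word
    appears with probability at least \<open>\<alpha>\<^sub>0^k\<close>.

  \<^item> \<open>pr_deviation\<close>: if the next symbol after \<open>u\<close> is \<open>a\<close> with conditional probability at most \<open>\<beta>\<close>, then
    \<open>N(u,a) - \<beta> N(u)\<close> exceeds \<open>z\<close> with probability at most \<open>exp (- z\<^sup>2 / (4 m))\<close>; symmetrically for
    lower bounds. This is the Azuma--Hoeffding argument for a supermartingale.

  On the statistical side, a bounded tree is a set of words that cuts every word of length \<open>d\<close> at
  exactly one suffix. Replacing part of such a set by observed words that cover the same words of
  length \<open>d\<close> keeps it feasible, so optimality of the estimator bounds the change of log-likelihood by the change of
  penalty (\<open>arg_min_exchange\<close>).

  Underestimation: suppose an internal node \<open>w\<close> of the true tree is selected. As \<open>w\<close> does not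
  determine the next symbol, continuity yields two extensions \<open>u1\<close>, \<open>u2\<close> of \<open>w\<close> of a common length
  \<open>k\<close> after which some symbol has conditional probabilities separated by a gap. Both are frequent
  and their empirical frequencies stay separated, except with probability exponentially small in
  \<open>m\<close>. Splitting \<open>w\<close> into all its extensions of length \<open>k\<close> then gains log-likelihood of order \<open>m\<close>
  (\<open>refinement_gain\<close>), whereas the penalty grows by at most \<open>\<bar>A\<bar>^k f(n)\<close>, which is
  of smaller order when \<open>f(n) / m\<close> tends to \<open>0\<close>.

  Overestimation: suppose the estimator selects a proper descendant of a context \<open>v\<close>. Pruning the
  branch below \<open>v\<close> saves at least half the penalty of that branch, so some selected descendant \<open>u\<close>
  of \<open>v\<close> has likelihood excess at least \<open>f(n)/2\<close> over the true law \<open>p(. | v)\<close>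
  (\<open>overestimation_excess\<close>). The excess is at most a chi-square distance, so for some symbol \<open>a\<close> the
  count \<open>N(u,a)\<close> deviates from \<open>p(a | v) N(u)\<close> by a multiple of \<open>sqrt (f(n) N(u))\<close>. With \<open>N(u)\<close> of
  order at least \<open>m \<alpha>\<^sub>0^d / d\<close> this has probability at most \<open>exp (- c f(n) \<alpha>\<^sub>0^d / d)\<close>, and
  there are at most \<open>2 \<bar>A\<bar>^d\<close> words \<open>u\<close>.
\<close>

section \<open>Bounded trees as complete suffix codes\<close>

lemma recent_length [simp]: "length (recent x j) = j"
  by (simp add: recent_def)

lemma recent_nth: "i < j \<Longrightarrow> recent x j ! i = x (j - Suc i)"
  by (simp add: recent_def rev_nth)

lemma suffix_same_length: "suffix s z \<Longrightarrow> length s = length z \<Longrightarrow> s = z"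
  by (auto simp: suffix_def)

lemma suffix_recent_iff:
  assumes "length s \<le> j"
  shows "suffix s (recent x j) \<longleftrightarrow> s = recent x (length s)"
proof -
  have *: "suffix (recent x k) (recent x j)" if "k \<le> j" for k
  proof -
    have "[0..<j] = [0..<k] @ [k..<j]"
      using that by (metis le_add_diff_inverse upt_add_eq_append zero_le)
    then have "recent x j = rev (map x [k..<j]) @ recent x k"
      by (simp add: recent_def)
    then show ?thesis by (rule suffixI)
  qed
  show ?thesis
  proof
    assume "suffix s (recent x j)"
    then have "suffix s (recent x (length s)) \<or> suffix (recent x (length s)) s"
      using *[OF assms] by (rule suffix_same_cases)
    then show "s = recent x (length s)"
      by (metis recent_length suffix_same_length)
  qed (metis * assms)
qed

lemma ex_recent: "\<exists>x. recent x (length z) = z"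
proof -
  have "recent (\<lambda>i. rev z ! i) (length z) = z"
    by (rule nth_equalityI) (auto simp: recent_nth rev_nth)
  then show ?thesis by blast
qed

lemma ex_suffix_longer:
  assumes "length s \<le> d"
  obtains z where "length z = d" "suffix s z"
  using assms by (intro that[of "replicate (d - length s) undefined @ s"]) (auto simp: suffix_def)

lemma suffix_take_iff:
  assumes "length w \<le> d" "d \<le> t" "t \<le> length xs"
  shows "suffix w (take t xs) \<longleftrightarrow> suffix w (drop (t - d) (take t xs))"
proof
  have z: "suffix (drop (t - d) (take t xs)) (take t xs)"
    by (rule suffix_drop)
  assume "suffix w (take t xs)"
  from suffix_length_suffix[OF this z] show "suffix w (drop (t - d) (take t xs))"
    using assms by simp
next
  assume "suffix w (drop (t - d) (take t xs))"
  then show "suffix w (take t xs)" using suffix_drop by (rule suffix_order.trans)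
qed

text \<open>
  The number of words of \<open>S\<close> that are suffixes of \<open>z\<close>. Sets with the same cover on words of length
  \<open>d\<close> are interchangeable inside a tree of height at most \<open>d\<close>, and they have the same total counts.
\<close>

definition cover :: "'a list set \<Rightarrow> 'a list \<Rightarrow> nat"
  where "cover S z = (\<Sum>s\<in>S. of_bool (suffix s z))"

lemma cover_eq_card: "finite S \<Longrightarrow> cover S z = card {s\<in>S. suffix s z}"
  by (simp add: cover_def of_bool_def sum.If_cases Int_def)

definition complete_code :: "nat \<Rightarrow> 'a list set \<Rightarrow> bool"
  where "complete_code d T \<longleftrightarrow> (\<forall>w\<in>T. length w \<le> d) \<and> (\<forall>z. length z = d \<longrightarrow> cover T z = 1)"

lemma finite_bounded_words: "\<forall>w\<in>T. length w \<le> d \<Longrightarrow> finite (T :: 'a::finite list set)"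
  by (rule finite_subset[OF _ finite_lists_length_le[of UNIV d]]) auto

lemma height_Fin_le_iff: "height (Fin ` T) \<le> enat d \<longleftrightarrow> (\<forall>w\<in>T. length w \<le> d)"
  by (auto simp: height_def SUP_le_iff)

lemma complete_tree_Fin_iff:
  "complete_tree (Fin ` T) \<longleftrightarrow> (\<forall>x. \<exists>s\<in>T. s = recent x (length s))"
  by (simp add: complete_tree_def suffix_eq_def)

lemma cover_eq_1_iff:
  assumes "finite S"
  shows "cover S z = 1 \<longleftrightarrow> (\<exists>!s. s \<in> S \<and> suffix s z)"
proof -
  have "cover S z = 1 \<longleftrightarrow> (\<exists>x. {s\<in>S. suffix s z} = {x})"
    by (simp add: cover_eq_card[OF assms] card_1_singleton_iff)
  also have "\<dots> \<longleftrightarrow> (\<exists>!s. s \<in> S \<and> suffix s z)"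
    unfolding Ex1_def set_eq_iff mem_Collect_eq singleton_iff by blast
  finally show ?thesis .
qed

text \<open>
  A semi-infinite past matters to a tree of height at most \<open>d\<close> only through its last \<open>d\<close> symbols, so
  completeness says that every word of length \<open>d\<close> has a suffix in the tree, and the tree property
  that it has at most one. For the clause on observed words \<open>w'\<close>, pad \<open>w'\<close> to length \<open>d\<close>: the suffix
  found in the tree and \<open>w'\<close> are suffixes of the same word, hence comparable.
\<close>

lemma feasible_iff:
  fixes T :: "'a::finite list set"
  shows "feasible d xs T \<longleftrightarrow> complete_code d T \<and> (\<forall>w\<in>T. count_word d xs w \<ge> 1)"
proof (cases "\<forall>w\<in>T. length w \<le> d")
  case len: True
  then have fin: "finite T" by (rule finite_bounded_words)
  have compl: "complete_tree (Fin ` T) \<longleftrightarrow> (\<forall>z. length z = d \<longrightarrow> (\<exists>s\<in>T. suffix s z))"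
    (is "?l \<longleftrightarrow> ?r")
  proof
    assume ?l
    show ?r
    proof (intro allI impI)
      fix z :: "'a list" assume z: "length z = d"
      obtain x where x: "recent x d = z" using ex_recent[of z] z by auto
      then obtain s where "s \<in> T" "s = recent x (length s)"
        using \<open>?l\<close> unfolding complete_tree_Fin_iff by blast
      with len x show "\<exists>s\<in>T. suffix s z"
        using suffix_recent_iff[of s d x] by blast
    qed
  next
    assume ?r
    then show ?l unfolding complete_tree_Fin_iff
      by (metis len recent_length suffix_recent_iff)
  qed
  have tree: "is_tree (Fin ` T) \<longleftrightarrow>
      (\<forall>z. length z = d \<longrightarrow> (\<forall>s\<in>T. \<forall>w\<in>T. suffix s z \<longrightarrow> suffix w z \<longrightarrow> s = w))" (is "?l \<longleftrightarrow> ?r")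
  proof
    assume ?l
    then show ?r
      by (auto simp: is_tree_def strict_suffix_def) (metis suffix_same_cases)
  next
    assume r: ?r
    have False if "s \<in> T" "w \<in> T" "strict_suffix s w" for s w
    proof -
      obtain z where "length z = d" "suffix w z"
        using ex_suffix_longer[of w d] len \<open>w \<in> T\<close> by blast
      then show False
        using r that by (metis strict_suffix_def suffix_order.trans)
    qed
    then show ?l by (auto simp add: is_tree_def)
  qed
  have ex1: "(\<forall>z. length z = d \<longrightarrow> cover T z = 1) \<longleftrightarrow> complete_tree (Fin ` T) \<and> is_tree (Fin ` T)"
    unfolding compl tree cover_eq_1_iff[OF fin] by blast
  have last: "w' \<in> T \<or> (\<exists>w\<in>T. proper_suffix (Fin w') (Fin w)) \<or> (\<exists>s\<in>T. proper_suffix (Fin s) (Fin w'))"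
    if ct: "complete_tree (Fin ` T)" and l: "length w' \<le> d" for w'
  proof -
    obtain z where "length z = d" "suffix w' z" using ex_suffix_longer[OF l] .
    then show ?thesis using ct[unfolded compl]
      by (metis proper_suffix.simps(1) strict_suffix_def suffix_same_cases)
  qed
  show ?thesis
    using len last ex1
    unfolding feasible_def complete_code_def height_Fin_le_iff by blast
next
  case False
  then show ?thesis by (auto simp: feasible_def complete_code_def height_Fin_le_iff)
qed

text \<open>
  Equality of covers also keeps \<open>R\<close> away from the retained words: a common word, padded to length
  \<open>d\<close>, would be covered twice by \<open>T\<close>.
\<close>

lemma complete_code_exchange:
  fixes T :: "'a::finite list set"
  assumes T: "complete_code d T" and S: "S \<subseteq> T" and R: "\<forall>r\<in>R. length r \<le> d"
    and eq: "\<And>z. length z = d \<Longrightarrow> cover R z = cover S z"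
  shows "complete_code d (T - S \<union> R)" and "(T - S) \<inter> R = {}"
proof -
  have lenT: "\<forall>w\<in>T. length w \<le> d" and one: "\<And>z. length z = d \<Longrightarrow> cover T z = 1"
    using T by (auto simp: complete_code_def)
  note fin = finite_bounded_words[OF lenT] finite_bounded_words[OF R]
  have split: "cover T z = cover (T - S) z + cover S z" for z
    unfolding cover_def by (rule sum.subset_diff[OF S fin(1)])
  show disj: "(T - S) \<inter> R = {}"
  proof (rule ccontr)
    assume "(T - S) \<inter> R \<noteq> {}"
    then obtain r where r: "r \<in> T - S" "r \<in> R" by auto
    obtain z where z: "length z = d" "suffix r z" using ex_suffix_longer[of r d] R r by blast
    have one_le: "cover U z \<ge> 1" if "r \<in> U" "finite U" for U
      using member_le_sum[of r U "\<lambda>s. of_bool (suffix s z) :: nat"] that z(2) by (simp add: cover_def)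
    have "cover (T - S) z \<ge> 1" "cover R z \<ge> 1"
      using one_le r fin by simp_all
    then show False using split[of z] one[OF z(1)] eq[OF z(1)] by simp
  qed
  have "cover (T - S \<union> R) z = 1" if "length z = d" for z
  proof -
    have "cover (T - S \<union> R) z = cover (T - S) z + cover R z"
      unfolding cover_def by (rule sum.union_disjoint) (use fin disj in auto)
    then show ?thesis using split[of z] one[OF that] eq[OF that] by simp
  qed
  then show "complete_code d (T - S \<union> R)"
    using lenT R by (auto simp: complete_code_def)
qed

text \<open>
  List positions are counted from \<open>0\<close>, so time \<open>t + 1\<close> of the sample is \<open>xs ! t\<close> and its past is
  \<open>take t xs\<close>.
\<close>

lemma count_next_eq:
  assumes "length w \<le> d"
  shows "count_next d xs w a =
    (\<Sum>t\<in>{d..<length xs}. of_bool (suffix w (take t xs) \<and> xs ! t = a))"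
proof -
  have seg: "segment xs (Suc t - length w) t = w \<longleftrightarrow> suffix w (take t xs)"
    if t: "t \<in> {d..<length xs}" for t
  proof -
    have l: "length w \<le> t" "t < length xs" using t assms by auto
    have s: "segment xs (Suc t - length w) t = drop (t - length w) (take t xs)"
      by (rule nth_equalityI) (use l in \<open>auto simp: segment_def obs_def simp del: upt_Suc intro!: arg_cong[where f="nth xs"]\<close>)
    show ?thesis unfolding s
    proof
      assume "suffix w (take t xs)"
      moreover have "suffix (drop (t - length w) (take t xs)) (take t xs)" by (rule suffix_drop)
      ultimately have "suffix w (drop (t - length w) (take t xs))"
        by (rule suffix_length_suffix) (use l in simp)
      then show "drop (t - length w) (take t xs) = w"
        using l suffix_same_length by fastforce
    qed (metis suffix_drop)
  qed
  have "count_next d xs w a =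
      (\<Sum>t\<in>{Suc d..<Suc (length xs)}. of_bool (segment xs (t - length w) (t - 1) = w \<and> obs xs t = a))"
    unfolding count_next_def by (rule sum.cong) auto
  also have "\<dots> = (\<Sum>t\<in>{d..<length xs}. of_bool (segment xs (Suc t - length w) t = w \<and> xs ! t = a))"
    by (subst sum.shift_bounds_Suc_ivl) (simp add: obs_def)
  also have "\<dots> = (\<Sum>t\<in>{d..<length xs}. of_bool (suffix w (take t xs) \<and> xs ! t = a))"
    by (rule sum.cong) (use seg in auto)
  finally show ?thesis .
qed

lemma count_word_eq:
  fixes w :: "'a::finite list"
  assumes "length w \<le> d"
  shows "count_word d xs w = (\<Sum>t\<in>{d..<length xs}. of_bool (suffix w (take t xs)))"
proof -
  have "count_word d xs w = (\<Sum>t\<in>{d..<length xs}. \<Sum>a\<in>UNIV. of_bool (suffix w (take t xs) \<and> xs ! t = a))"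
    unfolding count_word_def count_next_eq[OF assms] by (rule sum.swap)
  also have "\<dots> = (\<Sum>t\<in>{d..<length xs}. of_bool (suffix w (take t xs)))"
    by (intro sum.cong refl) (simp add: of_bool_def sum.delta)
  finally show ?thesis .
qed

lemma count_word_le: "length w \<le> d \<Longrightarrow> count_word d xs w \<le> length xs - d"
  for w :: "'a::finite list"
proof -
  assume "length w \<le> d"
  then have "count_word d xs w \<le> (\<Sum>t\<in>{d..<length xs}. 1)"
    unfolding count_word_eq[OF \<open>length w \<le> d\<close>] by (intro sum_mono) simp
  then show ?thesis by simp
qed

lemma count_next_snoc:
  assumes "length w \<le> d"
  shows "count_next d (xs @ [b]) w a =
    count_next d xs w a + of_bool (d \<le> length xs \<and> suffix w xs \<and> b = a)"
proof (cases "d \<le> length xs")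
  case True
  then show ?thesis
    unfolding count_next_eq[OF assms] by (simp add: nth_append)
next
  case False
  then show ?thesis unfolding count_next_eq[OF assms] by simp
qed

lemma count_word_snoc:
  fixes w :: "'a::finite list"
  assumes "length w \<le> d"
  shows "count_word d (xs @ [b]) w = count_word d xs w + of_bool (d \<le> length xs \<and> suffix w xs)"
  unfolding count_word_def count_next_snoc[OF assms] sum.distrib
proof -
  have "(\<Sum>a\<in>UNIV. of_bool (d \<le> length xs \<and> suffix w xs \<and> b = a)) =
      (\<Sum>a\<in>UNIV. if a = b then of_bool (d \<le> length xs \<and> suffix w xs) else (0::nat))"
    by (rule sum.cong) auto
  then show "(\<Sum>a\<in>UNIV. count_next d xs w a) +
      (\<Sum>a\<in>UNIV. of_bool (d \<le> length xs \<and> suffix w xs \<and> b = a)) =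
      (\<Sum>a\<in>UNIV. count_next d xs w a) + of_bool (d \<le> length xs \<and> suffix w xs)"
    by (simp add: sum.delta)
qed

text \<open>
  For words of length at most \<open>d\<close>, the last \<open>d\<close> symbols decide which of them have just occurred, and
  counting starts only when \<open>d\<close> symbols are available. So the total count depends on \<open>S\<close> only
  through its cover.
\<close>

lemma sum_count_next_cover:
  fixes S :: "'a::finite list set"
  assumes S: "\<forall>s\<in>S. length s \<le> d"
  shows "(\<Sum>s\<in>S. count_next d xs s a) =
    (\<Sum>t\<in>{d..<length xs}. of_bool (xs ! t = a) * cover S (drop (t - d) (take t xs)))"
proof -
  have "(\<Sum>s\<in>S. count_next d xs s a) =
      (\<Sum>s\<in>S. \<Sum>t\<in>{d..<length xs}. of_bool (xs ! t = a) * of_bool (suffix s (drop (t - d) (take t xs))))"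
    using S by (intro sum.cong refl) (auto simp: count_next_eq suffix_take_iff of_bool_conj mult.commute simp del: sum_of_bool_eq intro!: sum.cong)
  also have "\<dots> = (\<Sum>t\<in>{d..<length xs}. of_bool (xs ! t = a) * cover S (drop (t - d) (take t xs)))"
    by (subst sum.swap) (simp add: cover_def sum_distrib_left)
  finally show ?thesis .
qed

lemma sum_count_next_cong:
  fixes S R :: "'a::finite list set"
  assumes "\<forall>s\<in>S. length s \<le> d" "\<forall>r\<in>R. length r \<le> d"
    and "\<And>z. length z = d \<Longrightarrow> cover R z = cover S z"
  shows "(\<Sum>r\<in>R. count_next d xs r a) = (\<Sum>s\<in>S. count_next d xs s a)"
  unfolding sum_count_next_cover[OF assms(1)] sum_count_next_cover[OF assms(2)]
  by (intro sum.cong refl) (simp add: assms(3))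

section \<open>Log-likelihood and local changes of an optimal tree\<close>

text \<open>
  The contribution of the leaf \<open>w\<close> to the maximized log-likelihood. Symbols never seen after \<open>w\<close>
  contribute \<open>0\<close>, in keeping with \<open>0^0 = 1\<close> in the likelihood.
\<close>

definition log_lik :: "nat \<Rightarrow> 'a::finite list \<Rightarrow> 'a list \<Rightarrow> real"
  where "log_lik d xs w = (\<Sum>a\<in>UNIV. count_next d xs w a * ln (p_hat d xs w a))"

lemma count_next_le_word: "count_next d xs w a \<le> count_word d xs w"
  unfolding count_word_def by (rule member_le_sum) auto

lemma ln_max_likelihood:
  "finite T \<Longrightarrow> ln (max_likelihood d xs T) = (\<Sum>w\<in>T. log_lik d xs w)"
proof -
  assume "finite T"
  have pos: "p_hat d xs w a ^ count_next d xs w a > 0" for w a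
    using count_next_le_word[of d xs w a] by (cases "count_next d xs w a") (auto simp: p_hat_def)
  have l: "ln (p_hat d xs w a ^ count_next d xs w a) = count_next d xs w a * ln (p_hat d xs w a)" for w a
    by (cases "count_next d xs w a = 0") (use pos[of w a] in \<open>auto simp: ln_realpow zero_less_power_eq ln_powr\<close>)
  show ?thesis
    unfolding max_likelihood_def log_lik_def
    using \<open>finite T\<close> pos[THEN less_imp_neq, symmetric]
    by (simp add: ln_prod prod_zero_iff l del: power_eq_0_iff)
qed

text \<open>
  The modified tree is feasible, so it does not beat \<open>T\<close>; the contributions of the words that are
  kept cancel.
\<close>

lemma arg_min_exchange:
  fixes T :: "'a::finite list set"
  assumes min: "is_arg_min (\<lambda>T. - ln (max_likelihood d xs T) + real (card T) * c) (feasible d xs) T"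
    and S: "S \<subseteq> T" and R: "\<forall>r\<in>R. length r \<le> d" "\<forall>r\<in>R. count_word d xs r \<ge> 1"
    and eq: "\<And>z. length z = d \<Longrightarrow> cover R z = cover S z"
  shows "(\<Sum>r\<in>R. log_lik d xs r) - (\<Sum>s\<in>S. log_lik d xs s) \<le> (real (card R) - real (card S)) * c"
proof -
  have feas: "feasible d xs T" using min by (simp add: is_arg_min_def)
  then have T: "complete_code d T" "\<forall>w\<in>T. count_word d xs w \<ge> 1" by (auto simp: feasible_iff)
  then have fin: "finite T" "finite R" "finite S"
    using S R finite_bounded_words finite_subset unfolding complete_code_def by metis+
  note ex = complete_code_exchange[OF T(1) S R(1) eq]
  have "feasible d xs (T - S \<union> R)"
    unfolding feasible_iff using ex(1) T(2) R(2) by auto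
  then have "- ln (max_likelihood d xs T) + real (card T) * c
      \<le> - ln (max_likelihood d xs (T - S \<union> R)) + real (card (T - S \<union> R)) * c"
    using min by (auto simp: is_arg_min_def not_less)
  moreover have "(\<Sum>w\<in>T. log_lik d xs w) = (\<Sum>w\<in>T - S. log_lik d xs w) + (\<Sum>s\<in>S. log_lik d xs s)"
    by (rule sum.subset_diff[OF S fin(1)])
  moreover have "(\<Sum>w\<in>T - S \<union> R. log_lik d xs w) = (\<Sum>w\<in>T - S. log_lik d xs w) + (\<Sum>r\<in>R. log_lik d xs r)"
    using ex(2) fin by (simp add: sum.union_disjoint)
  moreover have "real (card T) = real (card (T - S)) + real (card S)"
    using S fin by (metis card_Diff_subset card_mono le_add_diff_inverse2 of_nat_add)
  moreover have "real (card (T - S \<union> R)) = real (card (T - S)) + real (card R)"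
    using ex(2) fin by (simp add: card_Un_disjoint)
  ultimately show ?thesis
    using fin by (simp add: ln_max_likelihood algebra_simps)
qed

section \<open>Excess of the maximized log-likelihood over a fixed law\<close>

lemma sum_count_next: "(\<Sum>a\<in>UNIV. real (count_next d xs w a)) = real (count_word d xs w)"
  by (simp add: count_word_def)

lemma count_next_eq_p_hat: "real (count_next d xs w a) = p_hat d xs w a * real (count_word d xs w)"
  using count_next_le_word[of d xs w a] by (auto simp: p_hat_def)

lemma p_hat_nonneg: "0 \<le> p_hat d xs w a"
  by (simp add: p_hat_def)

lemma p_hat_le_1: "p_hat d xs w a \<le> 1"
  using count_next_le_word[of d xs w a] by (auto simp: p_hat_def divide_le_eq_1)

lemma sum_p_hat: "count_word d xs w \<ge> 1 \<Longrightarrow> (\<Sum>a\<in>UNIV. p_hat d xs w a) = 1"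
  by (simp add: p_hat_def sum_divide_distrib[symmetric] sum_count_next)

lemma p_hat_pos: "count_next d xs w a > 0 \<Longrightarrow> p_hat d xs w a > 0"
  using count_next_le_word[of d xs w a] by (auto simp: p_hat_def)

text \<open>
  The gain in log-likelihood at \<open>w\<close> from using the empirical distribution instead of \<open>r\<close>, that is,
  \<open>N(w)\<close> times the Kullback--Leibler divergence of the empirical distribution from \<open>r\<close>.
\<close>

definition excess :: "nat \<Rightarrow> 'a::finite list \<Rightarrow> 'a list \<Rightarrow> ('a \<Rightarrow> real) \<Rightarrow> real"
  where "excess d xs w r = (\<Sum>a\<in>UNIV. count_next d xs w a * (ln (p_hat d xs w a) - ln (r a)))"

lemma excess_eq: "excess d xs w r = log_lik d xs w - (\<Sum>a\<in>UNIV. count_next d xs w a * ln (r a))"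
  by (simp add: excess_def log_lik_def right_diff_distrib sum_subtractf)

text \<open>
  The divergence dominates the squared Hellinger distance, by \<open>ln t \<le> t - 1\<close> at
  \<open>t = sqrt (r a / p a)\<close>; and \<open>(p - r)\<^sup>2 = (sqrt p + sqrt r)\<^sup>2 (sqrt p - sqrt r)\<^sup>2\<close> with
  \<open>sqrt p + sqrt r \<le> 2\<close>. In particular the excess is nonnegative.
\<close>

lemma excess_ge_square:
  fixes r :: "'a::finite \<Rightarrow> real"
  assumes r: "\<And>a. r a \<ge> 0" "(\<Sum>a\<in>UNIV. r a) = 1" "\<And>a. count_next d xs w a > 0 \<Longrightarrow> r a > 0"
  shows "excess d xs w r \<ge> count_word d xs w / 4 * (p_hat d xs w b - r b)\<^sup>2"
proof (cases "count_word d xs w = 0")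
  case True
  then have "count_next d xs w a = 0" for a using count_next_le_word[of d xs w a] by simp
  then show ?thesis using True by (simp add: excess_def)
next
  case False
  define N where "N = real (count_word d xs w)"
  define p where "p = p_hat d xs w"
  have N: "N > 0" using False by (simp add: N_def)
  have p0: "p a \<ge> 0" for a by (simp add: p_def p_hat_nonneg)
  have p1: "p a \<le> 1" for a by (simp add: p_def p_hat_le_1)
  have ps: "(\<Sum>a\<in>UNIV. p a) = 1" using False by (simp add: p_def sum_p_hat)
  have r1: "r a \<le> 1" for a
    using member_le_sum[of a UNIV r] r(1,2) by simp
  have cn: "real (count_next d xs w a) = p a * N" for a
    by (simp add: p_def N_def count_next_eq_p_hat)
  have summand: "p a * (ln (p a) - ln (r a)) \<ge> 2 * p a - 2 * (sqrt (p a) * sqrt (r a))" for a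
  proof (cases "p a = 0")
    case False
    then have pa: "p a > 0" using p0[of a] by simp
    then have "real (count_next d xs w a) > 0" using cn[of a] N by simp
    then have ra: "r a > 0" using r(3) by simp
    have "ln (sqrt (r a) / sqrt (p a)) \<le> sqrt (r a) / sqrt (p a) - 1"
      using pa ra by (intro ln_le_minus_one) simp
    moreover have "ln (sqrt (r a) / sqrt (p a)) = (ln (r a) - ln (p a)) / 2"
      using pa ra by (simp add: ln_div ln_sqrt field_simps)
    ultimately have "ln (p a) - ln (r a) \<ge> 2 - 2 * (sqrt (r a) / sqrt (p a))" by simp
    then have "p a * (ln (p a) - ln (r a)) \<ge> p a * (2 - 2 * (sqrt (r a) / sqrt (p a)))"
      using pa by (intro mult_left_mono) auto
    moreover have "p a * (sqrt (r a) / sqrt (p a)) = sqrt (p a) * sqrt (r a)"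
      using pa by (metis less_eq_real_def mult.commute real_div_sqrt times_divide_eq_left times_divide_eq_right)
    moreover have "p a * (2 - 2 * (sqrt (r a) / sqrt (p a))) = 2 * p a - 2 * (p a * (sqrt (r a) / sqrt (p a)))"
      by (simp add: algebra_simps)
    ultimately show ?thesis by simp
  qed simp
  \<comment> \<open>the summands of the squared Hellinger distance\<close>
  have hell: "(sqrt (p a) - sqrt (r a))\<^sup>2 = p a + r a - 2 * (sqrt (p a) * sqrt (r a))" for a
    using p0[of a] r(1)[of a] by (simp add: power2_diff)
  have "(p b - r b)\<^sup>2 = (sqrt (p b) + sqrt (r b))\<^sup>2 * (sqrt (p b) - sqrt (r b))\<^sup>2"
    using p0[of b] r(1)[of b]
    by (simp add: power_mult_distrib[symmetric]) (simp add: algebra_simps)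
  also have "\<dots> \<le> 2\<^sup>2 * (sqrt (p b) - sqrt (r b))\<^sup>2"
    using p0[of b] p1[of b] r(1)[of b] r1[of b]
    by (intro mult_right_mono power_mono) (auto intro: add_mono[of "sqrt (p b)" 1 "sqrt (r b)" 1, simplified])
  also have "(sqrt (p b) - sqrt (r b))\<^sup>2 \<le> (\<Sum>a\<in>UNIV. (sqrt (p a) - sqrt (r a))\<^sup>2)"
    by (rule member_le_sum) auto
  also have "(\<Sum>a\<in>UNIV. (sqrt (p a) - sqrt (r a))\<^sup>2) = (\<Sum>a\<in>UNIV. 2 * p a - 2 * (sqrt (p a) * sqrt (r a)))"
    unfolding hell by (simp add: sum_subtractf sum.distrib sum_distrib_left[symmetric] ps r(2))
  also have "\<dots> \<le> (\<Sum>a\<in>UNIV. p a * (ln (p a) - ln (r a)))"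
    by (intro sum_mono summand)
  finally have "(p b - r b)\<^sup>2 / 4 \<le> (\<Sum>a\<in>UNIV. p a * (ln (p a) - ln (r a)))" by simp
  then have "N * ((p b - r b)\<^sup>2 / 4) \<le> N * (\<Sum>a\<in>UNIV. p a * (ln (p a) - ln (r a)))"
    using N by (intro mult_left_mono) auto
  also have "\<dots> = excess d xs w r"
    unfolding excess_def cn p_def[symmetric] by (simp add: sum_distrib_left mult_ac)
  finally show ?thesis by (simp add: N_def p_def)
qed

text \<open>
  The inequality \<open>ln t \<le> t - 1\<close> at \<open>t = p a / r a\<close> bounds the divergence by the chi-square distance.
\<close>

lemma excess_le_chi_square:
  fixes r :: "'a::finite \<Rightarrow> real"
  assumes r: "\<And>a. r a > 0" "(\<Sum>a\<in>UNIV. r a) = 1"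
  shows "excess d xs w r \<le>
    (\<Sum>a\<in>UNIV. (count_next d xs w a - r a * count_word d xs w)\<^sup>2 / (r a * count_word d xs w))"
proof (cases "count_word d xs w = 0")
  case True
  then have "count_next d xs w a = 0" for a using count_next_le_word[of d xs w a] by simp
  then show ?thesis using True by (simp add: excess_def)
next
  case False
  define N where "N = real (count_word d xs w)"
  define c where "c a = real (count_next d xs w a)" for a
  have N: "N > 0" using False by (simp add: N_def)
  have summand: "c a * (ln (c a / N) - ln (r a)) \<le> c a * (c a / (N * r a) - 1)" for a
  proof (cases "c a = 0")
    case False
    then have ca: "c a > 0" by (simp add: c_def)
    have "ln (c a / N) - ln (r a) = ln (c a / (N * r a))"
      using ca N r(1)[of a] by (simp add: ln_div ln_mult)
    also have "\<dots> \<le> c a / (N * r a) - 1"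
      using ca N r(1)[of a] by (intro ln_le_minus_one) simp
    finally show ?thesis using ca by (intro mult_left_mono) auto
  qed simp
  have sq: "(c a - r a * N)\<^sup>2 / (r a * N) = c a * (c a / (N * r a) - 1) - c a + r a * N" for a
    using N r(1)[of a] by (simp add: field_simps power2_eq_square)
  have "excess d xs w r = (\<Sum>a\<in>UNIV. c a * (ln (c a / N) - ln (r a)))"
    by (simp add: excess_def c_def N_def p_hat_def)
  also have "\<dots> \<le> (\<Sum>a\<in>UNIV. c a * (c a / (N * r a) - 1))"
    by (intro sum_mono summand)
  also have "\<dots> = (\<Sum>a\<in>UNIV. (c a - r a * N)\<^sup>2 / (r a * N))"
    unfolding sq sum.distrib sum_subtractf
    by (simp add: sum_distrib_right[symmetric] r(2)) (simp add: c_def N_def sum_count_next)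
  finally show ?thesis by (simp add: c_def N_def)
qed

lemma excess_le_ln:
  fixes r :: "'a::finite \<Rightarrow> real"
  assumes r: "\<And>a. r a \<ge> p0" "p0 > 0"
  shows "excess d xs w r \<le> count_word d xs w * ln (1 / p0)"
proof -
  have "excess d xs w r \<le> (\<Sum>a\<in>UNIV. real (count_next d xs w a) * ln (1 / p0))"
    unfolding excess_def
  proof (rule sum_mono)
    fix a
    have "ln (p_hat d xs w a) - ln (r a) \<le> ln (1 / p0)" if "count_next d xs w a > 0"
    proof -
      have "ln (p_hat d xs w a) \<le> 0" using p_hat_le_1 p_hat_pos[OF that] by simp
      moreover have "ln p0 \<le> ln (r a)" using r(1)[of a] r(2) by simp
      ultimately show ?thesis using r(2) by (simp add: ln_div)
    qed
    then show "real (count_next d xs w a) * (ln (p_hat d xs w a) - ln (r a))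
        \<le> real (count_next d xs w a) * ln (1 / p0)"
      by (cases "count_next d xs w a = 0") (auto intro: mult_left_mono)
  qed
  also have "\<dots> = count_word d xs w * ln (1 / p0)"
    by (simp add: sum_distrib_right[symmetric] sum_count_next)
  finally show ?thesis .
qed

text \<open>
  The words of \<open>S\<close> share out the counts of \<open>w\<close>, so the terms with \<open>ln (r a)\<close> add up to those of \<open>w\<close>.
\<close>

lemma sum_excess_cover:
  fixes S :: "'a::finite list set"
  assumes "\<forall>s\<in>S. length s \<le> d" "length w \<le> d" "\<And>z. length z = d \<Longrightarrow> cover S z = cover {w} z"
  shows "(\<Sum>s\<in>S. excess d xs s r) = (\<Sum>s\<in>S. log_lik d xs s) - (\<Sum>a\<in>UNIV. count_next d xs w a * ln (r a))"
proof -
  have "(\<Sum>s\<in>S. \<Sum>a\<in>UNIV. real (count_next d xs s a) * ln (r a)) =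
      (\<Sum>a\<in>UNIV. real (\<Sum>s\<in>S. count_next d xs s a) * ln (r a))"
    by (subst sum.swap) (simp add: sum_distrib_right)
  also have "\<dots> = (\<Sum>a\<in>UNIV. count_next d xs w a * ln (r a))"
    using sum_count_next_cong[of "{w}" d S] assms by simp
  finally show ?thesis
    by (simp add: excess_eq sum_subtractf)
qed

section \<open>Splitting a leaf and pruning a branch\<close>

definition extensions :: "'a list \<Rightarrow> nat \<Rightarrow> 'a list set"
  where "extensions w k = {u. length u = k \<and> suffix w u}"

lemma finite_extensions: "finite (extensions (w :: 'a::finite list) k)"
  by (rule finite_subset[OF _ finite_lists_length_eq[of UNIV k]]) (auto simp: extensions_def)

lemma card_extensions_le: "card (extensions (w :: 'a::finite list) k) \<le> CARD('a) ^ k"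
proof -
  have "card (extensions w k) \<le> card {u :: 'a list. set u \<subseteq> UNIV \<and> length u = k}"
    by (rule card_mono[OF finite_lists_length_eq]) (auto simp: extensions_def)
  also have "\<dots> = CARD('a) ^ k" by (rule card_lists_length_eq) simp
  finally show ?thesis .
qed

lemma cover_extensions:
  fixes w :: "'a::finite list"
  assumes "length w \<le> k" "k \<le> d" "length z = d"
  shows "cover (extensions w k) z = cover {w} z"
proof (cases "suffix w z")
  case True
  have "suffix (drop (d - k) z) z" by (rule suffix_drop)
  moreover from suffix_length_suffix[OF True this] have "suffix w (drop (d - k) z)"
    using assms by simp
  moreover have "u = drop (d - k) z" if "suffix u z" "length u = k" for u
    using suffix_same_length[of u "drop (d - k) z"] suffix_length_suffix[OF that(1) suffix_drop[of "d - k" z]]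
    that assms by simp
  moreover have "length (drop (d - k) z) = k" using assms by simp
  ultimately have "\<exists>!u. u \<in> extensions w k \<and> suffix u z"
    unfolding extensions_def mem_Collect_eq by blast
  then show ?thesis
    using True cover_eq_1_iff[OF finite_extensions[of w k], of z] by (simp add: cover_def[of "{w}"])
next
  case False
  then have "\<not> suffix u z" if "u \<in> extensions w k" for u
    using that suffix_order.trans[of w u z] by (auto simp: extensions_def)
  then show ?thesis using False by (simp add: cover_def del: sum_of_bool_eq)
qed

text \<open>
  Splitting \<open>w\<close> into its extensions gains the sum of their excesses over the empirical distribution
  at \<open>w\<close>. No excess is negative, and that distribution cannot be close to the empirical
  distributions at both \<open>u1\<close> and \<open>u2\<close>.
\<close>

lemma refinement_gain:
  fixes w :: "'a::finite list" and N \<gamma> :: real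
  assumes k: "length w \<le> k" "k \<le> d"
    and u: "u1 \<in> extensions w k" "u2 \<in> extensions w k"
    and N: "N \<ge> 0" "count_word d xs u1 \<ge> N" "count_word d xs u2 \<ge> N" "count_word d xs w \<ge> 1"
    and gap: "\<gamma> > 0" "p_hat d xs u1 a + \<gamma> \<le> p_hat d xs u2 a"
  shows "(\<Sum>u\<in>extensions w k. log_lik d xs u) - log_lik d xs w \<ge> N * \<gamma>\<^sup>2 / 8"
proof -
  define r where "r = p_hat d xs w"
  define R where "R = extensions w k"
  have R: "\<forall>u\<in>R. length u \<le> d" "finite R"
    using k by (auto simp: R_def extensions_def intro: finite_extensions[unfolded extensions_def])
  have cov: "\<And>z. length z = d \<Longrightarrow> cover R z = cover {w} z"
    unfolding R_def by (rule cover_extensions[OF k])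
  have wd: "length w \<le> d" using k by simp
  have sum_next: "(\<Sum>u\<in>R. count_next d xs u b) = count_next d xs w b" for b
    using sum_count_next_cong[of "{w}" d R] R wd cov by simp
  \<comment> \<open>a symbol seen after an extension of \<open>w\<close> has been seen after \<open>w\<close>\<close>
  have rpos: "r b > 0" if "u \<in> R" "count_next d xs u b > 0" for u b
  proof -
    have "count_next d xs u b \<le> (\<Sum>u\<in>R. count_next d xs u b)"
      by (rule member_le_sum) (use that R in auto)
    then show ?thesis unfolding sum_next r_def using that by (intro p_hat_pos) simp
  qed
  have rs: "\<And>b. r b \<ge> 0" "(\<Sum>b\<in>UNIV. r b) = 1"
    using N by (auto simp: r_def p_hat_nonneg sum_p_hat)
  have ex: "excess d xs u r \<ge> count_word d xs u / 4 * (p_hat d xs u a - r a)\<^sup>2" if "u \<in> R" for u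
    by (rule excess_ge_square) (use rs rpos that in auto)
  have ex0: "excess d xs u r \<ge> 0" if "u \<in> R" for u
    by (rule order_trans[OF _ ex[OF that]]) simp
  have ne: "u1 \<noteq> u2" using gap by auto
  have exN: "excess d xs u r \<ge> N / 4 * (p_hat d xs u a - r a)\<^sup>2"
    if "u \<in> R" "count_word d xs u \<ge> N" for u
    by (rule order_trans[OF _ ex[OF that(1)]]) (use that in \<open>simp add: mult_right_mono\<close>)
  have "\<gamma>\<^sup>2 \<le> (p_hat d xs u2 a - p_hat d xs u1 a)\<^sup>2"
    using gap by (intro power_mono) auto
  also have "\<dots> \<le> 2 * ((p_hat d xs u1 a - r a)\<^sup>2 + (p_hat d xs u2 a - r a)\<^sup>2)"
    using zero_le_power2[of "p_hat d xs u1 a + p_hat d xs u2 a - 2 * r a"]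
    by (simp add: power2_eq_square algebra_simps)
  finally have "N * \<gamma>\<^sup>2 / 8 \<le> N / 8 * (2 * ((p_hat d xs u1 a - r a)\<^sup>2 + (p_hat d xs u2 a - r a)\<^sup>2))"
    using mult_left_mono[of "\<gamma>\<^sup>2" _ "N / 8"] N by simp
  also have "\<dots> = N / 4 * (p_hat d xs u1 a - r a)\<^sup>2 + N / 4 * (p_hat d xs u2 a - r a)\<^sup>2"
    by (simp add: algebra_simps)
  also have "\<dots> \<le> excess d xs u1 r + excess d xs u2 r"
    using u N by (intro add_mono exN) (auto simp: R_def)
  also have "\<dots> = (\<Sum>u\<in>{u1, u2}. excess d xs u r)" using ne by simp
  also have "\<dots> \<le> (\<Sum>u\<in>R. excess d xs u r)"
    by (rule sum_mono2) (use u R ex0 in \<open>auto simp: R_def\<close>)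
  also have "\<dots> = (\<Sum>u\<in>R. log_lik d xs u) - log_lik d xs w"
    using sum_excess_cover[OF R(1) wd cov, of xs r] by (simp add: log_lik_def[of d xs w] r_def)
  finally show ?thesis by (simp add: R_def)
qed

lemma complete_code_unique:
  fixes T :: "'a::finite list set"
  assumes "complete_code d T" "s \<in> T" "t \<in> T" "suffix s t"
  shows "s = t"
proof -
  have len: "\<forall>w\<in>T. length w \<le> d" using assms(1) by (simp add: complete_code_def)
  obtain z where z: "length z = d" "suffix t z"
    using ex_suffix_longer[of t d] len assms(3) by blast
  then have "\<exists>!s. s \<in> T \<and> suffix s z"
    using assms(1) cover_eq_1_iff[OF finite_bounded_words[OF len]] by (simp add: complete_code_def)
  moreover have "suffix s z" using assms(4) z(2) by (rule suffix_order.trans)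
  ultimately show ?thesis using assms(2,3) z(2) by blast
qed

lemma complete_code_ex:
  fixes T :: "'a::finite list set"
  assumes "complete_code d T" "length z = d"
  shows "\<exists>!s. s \<in> T \<and> suffix s z"
  using assms cover_eq_1_iff[OF finite_bounded_words[of T d]] by (auto simp: complete_code_def)

text \<open>
  A word that ends in \<open>v\<close> cannot be cut by \<open>T\<close> at a suffix of \<open>v\<close>, because that would be a suffix of
  \<open>w \<in> T\<close>; so it is cut strictly below \<open>v\<close>.
\<close>

lemma cover_descendants:
  fixes T :: "'a::finite list set"
  assumes T: "complete_code d T" and w: "w \<in> T" "strict_suffix v w" and z: "length z = d"
  shows "cover {u\<in>T. strict_suffix v u} z = cover {v} z"
proof -
  have fin: "finite {u\<in>T. strict_suffix v u}"
    using T finite_bounded_words[of T d] by (auto simp: complete_code_def)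
  show ?thesis
  proof (cases "suffix v z")
    case True
    obtain s where s: "s \<in> T" "suffix s z" "\<And>t. t \<in> T \<Longrightarrow> suffix t z \<Longrightarrow> t = s"
      using complete_code_ex[OF T z] by auto
    have "\<not> suffix s v"
      using complete_code_unique[OF T s(1) w(1)] w(2)
      by (metis strict_suffix_def suffix_order.antisym suffix_order.trans)
    then have "strict_suffix v s"
      using suffix_same_cases[OF True s(2)] by (auto simp: strict_suffix_def)
    then have "\<exists>!u. u \<in> {u\<in>T. strict_suffix v u} \<and> suffix u z" using s by blast
    then have "cover {u\<in>T. strict_suffix v u} z = 1" by (simp only: cover_eq_1_iff[OF fin])
    then show ?thesis using True by (simp add: cover_def[of "{v}"])
  next
    case False
    then have "\<not> suffix u z" if "strict_suffix v u" for u
      using that suffix_order.trans[of v u z] by (auto simp: strict_suffix_def)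
    then show ?thesis using False by (simp add: cover_def del: sum_of_bool_eq)
  qed
qed

text \<open>
  If \<open>c\<close> is the symbol preceding \<open>v\<close> in \<open>w\<close>, then some descendant of \<open>v\<close> must cover the words ending
  in \<open>b v\<close> for another symbol \<open>b\<close>, and \<open>w\<close> does not.
\<close>

lemma card_descendants_ge_2:
  fixes T :: "'a::finite list set"
  assumes A: "CARD('a) \<ge> 2" and T: "complete_code d T" and w: "w \<in> T" "strict_suffix v w"
  shows "card {u\<in>T. strict_suffix v u} \<ge> 2"
proof -
  have len: "\<forall>w\<in>T. length w \<le> d" using T by (simp add: complete_code_def)
  have fin: "finite {u\<in>T. strict_suffix v u}" using finite_bounded_words[OF len] by simp
  obtain ys where ys: "w = ys @ v" "ys \<noteq> []"
    using w(2) by (auto simp: strict_suffix_def suffix_def)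
  obtain zs c where c: "w = zs @ c # v" using ys by (metis append_eq_append_conv2 append_Cons append_Nil append.assoc rev_exhaust)
  have "\<exists>b. b \<noteq> c"
  proof (rule ccontr)
    assume "\<nexists>b. b \<noteq> c"
    then have "(UNIV :: 'a set) = {c}" by auto
    then have "CARD('a) = card {c}" by (rule arg_cong)
    then show False using A by simp
  qed
  then obtain b where b: "b \<noteq> c" ..
  have "length (b # v) \<le> d" using len w(1) c by auto
  then obtain z where z: "length z = d" "suffix (b # v) z" by (rule ex_suffix_longer)
  then have vz: "suffix v z" by (auto simp: suffix_def)
  have "cover {u\<in>T. strict_suffix v u} z = 1"
    using cover_descendants[OF T w z(1)] vz by (simp add: cover_def[of "{v}"])
  then obtain s where s: "s \<in> T" "strict_suffix v s" "suffix s z"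
    using cover_eq_1_iff[OF fin] by blast
  have "s \<noteq> w"
  proof
    assume "s = w"
    then have "suffix (c # v) z" using s(3) c by (metis suffix_order.trans suffixI)
    then have "b # v = c # v" using z(2)
      by (metis length_Cons suffix_order.antisym suffix_length_suffix order_refl)
    then show False using b by simp
  qed
  then have "card {s, w} = 2" by simp
  then show ?thesis using card_mono[OF fin, of "{s, w}"] s w by simp
qed

section \<open>Deviation bounds for a consistent law on words\<close>

abbreviation words :: "nat \<Rightarrow> 'a list set"
  where "words n \<equiv> {xs. length xs = n}"

lemma finite_words: "finite (words n :: 'a::finite list set)"
  using finite_lists_length_eq[of "UNIV :: 'a set" n] by simp

lemma sum_words_add:
  fixes F :: "'a::finite list \<Rightarrow> real"
  shows "(\<Sum>zs\<in>words (m + k). F zs) = (\<Sum>xs\<in>words m. \<Sum>ys\<in>words k. F (xs @ ys))"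
proof -
  have "(\<Sum>xs\<in>words m. \<Sum>ys\<in>words k. F (xs @ ys)) = (\<Sum>(xs, ys)\<in>words m \<times> words k. F (xs @ ys))"
    by (rule sum.cartesian_product)
  also have "\<dots> = (\<Sum>zs\<in>words (m + k). F zs)"
    by (rule sum.reindex_bij_witness[where i = "\<lambda>zs. (take m zs, drop m zs)" and j = "\<lambda>(xs, ys). xs @ ys"])
      auto
  finally show ?thesis ..
qed

lemma sum_words_1:
  fixes F :: "'a::finite list \<Rightarrow> real"
  shows "(\<Sum>ys\<in>words 1. F ys) = (\<Sum>a\<in>UNIV. F [a])"
  by (rule sum.reindex_bij_witness[where i = "\<lambda>a. [a]" and j = hd]) (auto simp: length_Suc_conv)

text \<open>
  For negative \<open>y = - z\<close> this follows from \<open>exp z \<ge> 1 + z + z\<^sup>2 / 2\<close> and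
  \<open>(1 + z + z\<^sup>2 / 2) (1 - z + z\<^sup>2) \<ge> 1\<close>.
\<close>

lemma exp_le_quadratic:
  fixes y :: real
  assumes "\<bar>y\<bar> \<le> 1"
  shows "exp y \<le> 1 + y + y\<^sup>2"
proof (cases "y \<ge> 0")
  case True
  then show ?thesis using exp_bound[of y] assms by simp
next
  case False
  define z where "z = - y"
  have z: "z \<ge> 0" using False by (simp add: z_def)
  have "1 \<le> (1 + z + z\<^sup>2 / 2) * (1 - z + z\<^sup>2)"
  proof -
    have "(1 + z + z\<^sup>2 / 2) * (1 - z + z\<^sup>2) = 1 + (z ^ 2 + z ^ 3 + z ^ 4) / 2"
      by (simp add: field_simps eval_nat_numeral)
    then show ?thesis using z by simp
  qed
  also have "\<dots> \<le> exp z * (1 - z + z\<^sup>2)"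
  proof (rule mult_right_mono)
    show "1 + z + z\<^sup>2 / 2 \<le> exp z" using exp_lower_Taylor_quadratic[OF z] .
    have "(z - 1)\<^sup>2 = z\<^sup>2 - 2 * z + 1" by (simp add: power2_eq_square algebra_simps)
    then show "0 \<le> 1 - z + z\<^sup>2" using z zero_le_power2[of "z - 1"] by linarith
  qed
  finally have "exp (- z) \<le> 1 - z + z\<^sup>2" by (simp add: exp_minus field_simps)
  then show ?thesis by (simp add: z_def)
qed

text \<open>
  The probabilities \<open>\<mu> xs\<close> that a process on \<open>{1, 2, ...}\<close> starts with the word \<open>xs\<close>. Events that
  concern the first \<open>n\<close> symbols are handled as finite sums over words of length \<open>n\<close>.
\<close>

locale word_law =
  fixes \<mu> :: "'a::finite list \<Rightarrow> real"
  assumes nonneg: "\<mu> xs \<ge> 0"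
    and nil: "\<mu> [] = 1"
    and snoc: "(\<Sum>a\<in>UNIV. \<mu> (xs @ [a])) = \<mu> xs"
begin

definition expect :: "nat \<Rightarrow> ('a list \<Rightarrow> real) \<Rightarrow> real"
  where "expect n F = (\<Sum>xs\<in>words n. \<mu> xs * F xs)"

definition pr :: "nat \<Rightarrow> ('a list \<Rightarrow> bool) \<Rightarrow> real"
  where "pr n Q = expect n (\<lambda>xs. of_bool (Q xs))"

lemma expect_Suc: "expect (Suc n) F = (\<Sum>xs\<in>words n. \<Sum>a\<in>UNIV. \<mu> (xs @ [a]) * F (xs @ [a]))"
  using sum_words_add[of "\<lambda>zs. \<mu> zs * F zs" n 1]
  by (simp add: expect_def sum_words_1[of "\<lambda>ys. \<mu> (_ @ ys) * F (_ @ ys)", simplified])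

lemma sum_append: "(\<Sum>ys\<in>words k. \<mu> (xs @ ys)) = \<mu> xs"
proof (induction k)
  case (Suc k)
  have "(\<Sum>ys\<in>words (Suc k). \<mu> (xs @ ys)) = (\<Sum>ys\<in>words k. \<Sum>a\<in>UNIV. \<mu> ((xs @ ys) @ [a]))"
    using sum_words_add[of "\<lambda>zs. \<mu> (xs @ zs)" k 1] sum_words_1[of "\<lambda>zs. \<mu> (xs @ _ @ zs)"] by simp
  then show ?case by (simp only: snoc Suc)
qed simp

lemma expect_take:
  assumes "m \<le> n"
  shows "expect n (\<lambda>xs. F (take m xs)) = expect m F"
proof -
  have "expect n (\<lambda>xs. F (take m xs)) = (\<Sum>xs\<in>words m. \<Sum>ys\<in>words (n - m). \<mu> (xs @ ys) * F xs)"
    using sum_words_add[of "\<lambda>zs. \<mu> zs * F (take m zs)" m "n - m"] assms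
    by (simp add: expect_def)
  also have "\<dots> = (\<Sum>xs\<in>words m. (\<Sum>ys\<in>words (n - m). \<mu> (xs @ ys)) * F xs)"
    by (simp add: sum_distrib_right)
  finally show ?thesis by (simp add: sum_append expect_def)
qed

lemma expect_mono: "(\<And>xs. length xs = n \<Longrightarrow> F xs \<le> G xs) \<Longrightarrow> expect n F \<le> expect n G"
  unfolding expect_def by (intro sum_mono mult_left_mono nonneg) auto

lemma expect_cmult: "expect n (\<lambda>xs. c * F xs) = c * expect n F"
  by (simp add: expect_def sum_distrib_left mult_ac)

lemma pr_mono: "(\<And>xs. length xs = n \<Longrightarrow> Q xs \<Longrightarrow> R xs) \<Longrightarrow> pr n Q \<le> pr n R"
  unfolding pr_def by (rule expect_mono) auto

lemma pr_disj_le: "pr n (\<lambda>xs. Q xs \<or> R xs) \<le> pr n Q + pr n R"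
  unfolding pr_def expect_def sum.distrib[symmetric]
  by (intro sum_mono) (auto simp: nonneg)

lemma pr_bex_le:
  assumes "finite I"
  shows "pr n (\<lambda>xs. \<exists>i\<in>I. Q i xs) \<le> (\<Sum>i\<in>I. pr n (Q i))"
  using assms
proof (induction I rule: finite_induct)
  case empty
  then show ?case by (simp add: pr_def expect_def)
next
  case (insert i I)
  have "pr n (\<lambda>xs. \<exists>j\<in>insert i I. Q j xs) \<le> pr n (Q i) + pr n (\<lambda>xs. \<exists>j\<in>I. Q j xs)"
    using pr_disj_le[of n "Q i" "\<lambda>xs. \<exists>j\<in>I. Q j xs"] by simp
  then show ?case using insert by simp
qed

lemma pr_markov:
  assumes "\<And>xs. length xs = n \<Longrightarrow> F xs \<ge> 0" "\<And>xs. length xs = n \<Longrightarrow> Q xs \<Longrightarrow> c \<le> F xs" "c > 0"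
  shows "pr n Q \<le> expect n F / c"
proof -
  have "pr n Q \<le> expect n (\<lambda>xs. (1 / c) * F xs)"
    unfolding pr_def by (rule expect_mono) (use assms in \<open>auto simp: field_simps\<close>)
  then show ?thesis by (simp only: expect_cmult) simp
qed

lemma append_ge_power:
  assumes "\<And>xs a. \<mu> (xs @ [a]) \<ge> \<alpha> * \<mu> xs" "\<alpha> \<ge> 0"
  shows "\<mu> (xs @ u) \<ge> \<alpha> ^ length u * \<mu> xs"
proof (induction u rule: rev_induct)
  case (snoc a u)
  have "\<alpha> ^ length (u @ [a]) * \<mu> xs = \<alpha> * (\<alpha> ^ length u * \<mu> xs)" by simp
  also have "\<dots> \<le> \<alpha> * \<mu> (xs @ u)" using snoc assms(2) by (rule mult_left_mono)
  also have "\<dots> \<le> \<mu> (xs @ u @ [a])" using assms(1)[of "xs @ u" a] by simp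
  finally show ?case .
qed simp

text \<open>
  Each window multiplies the expectation by at most \<open>1 - \<theta> (1 - exp (-1)) \<le> 1 - \<theta> / 2\<close> with
  \<open>\<theta> = \<alpha>^k\<close>, because the word \<open>u\<close> fills it with conditional probability at least \<open>\<theta>\<close>.
\<close>

lemma expect_windows:
  assumes low: "\<And>xs a. \<mu> (xs @ [a]) \<ge> \<alpha> * \<mu> xs" "0 \<le> \<alpha>" "\<alpha> \<le> 1"
    and k: "length u = k"
  shows "expect (l + j * k) (\<lambda>xs. exp (- (\<Sum>i<j. of_bool (take k (drop (l + i * k) xs) = u))))
    \<le> exp (- (j * (\<alpha> ^ k / 2)))"
proof (induction j)
  case 0
  have "expect l (\<lambda>xs. 1) = 1"
    using sum_append[where xs = "[]" and k = l] by (simp add: expect_def nil)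
  then show ?case by simp
next
  case (Suc j)
  define \<theta> where "\<theta> = \<alpha> ^ k"
  define G where "G j xs = exp (- (\<Sum>i<j. of_bool (take k (drop (l + i * k) xs) = u) :: real))" for j xs
  have th: "0 \<le> \<theta>" "\<theta> \<le> 1" using low by (auto simp: \<theta>_def power_le_one)
  have e: "exp (-1) \<le> (1/2 :: real)"
  proof -
    have "(2::real) \<le> exp 1" using exp_ge_add_one_self[of "1::real"] by simp
    then show ?thesis by (simp add: exp_minus field_simps)
  qed
  have G: "G (Suc j) (xs @ ys) = G j xs * exp (- of_bool (ys = u))"
    if "length xs = l + j * k" "length ys = k" for xs ys
  proof -
    have win: "take k (drop (l + i * k) (xs @ ys)) = take k (drop (l + i * k) xs)" if "i < j" for i
    proof -
      have "i * k + k \<le> j * k" using that mult_le_mono1[of "Suc i" j k] by simp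
      then show ?thesis using \<open>length xs = _\<close> by simp
    qed
    have "(\<Sum>i<j. of_bool (take k (drop (l + i * k) (xs @ ys)) = u) :: real)
        = (\<Sum>i<j. of_bool (take k (drop (l + i * k) xs) = u))"
      by (intro sum.cong refl) (simp only: lessThan_iff win)
    then show ?thesis using that by (simp add: G_def exp_add[symmetric] del: sum_of_bool_eq)
  qed
  have inner: "(\<Sum>ys\<in>words k. \<mu> (xs @ ys) * exp (- of_bool (ys = u))) \<le> \<mu> xs * exp (- (\<theta> / 2))" for xs
  proof -
    have "(\<Sum>ys\<in>words k. \<mu> (xs @ ys) * exp (- of_bool (ys = u)))
        = (\<Sum>ys\<in>words k. \<mu> (xs @ ys) - (if ys = u then \<mu> (xs @ u) * (1 - exp (-1)) else 0))"
      by (intro sum.cong refl) (auto simp: algebra_simps)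
    also have "\<dots> = \<mu> xs - \<mu> (xs @ u) * (1 - exp (-1))"
      using k by (simp add: sum_subtractf sum_append sum.delta finite_words)
    also have "\<dots> \<le> \<mu> xs - (\<theta> * \<mu> xs) * (1 / 2)"
    proof -
      have "\<theta> * \<mu> xs \<le> \<mu> (xs @ u)"
        using append_ge_power[OF low(1,2), of u xs] k by (simp add: \<theta>_def)
      then have "(\<theta> * \<mu> xs) * (1 / 2) \<le> \<mu> (xs @ u) * (1 - exp (-1))"
        using e th nonneg by (intro mult_mono) auto
      then show ?thesis by simp
    qed
    also have "\<dots> = \<mu> xs * (1 + - (\<theta> / 2))" by (simp add: algebra_simps)
    also have "\<dots> \<le> \<mu> xs * exp (- (\<theta> / 2))"
      by (intro mult_left_mono nonneg exp_ge_add_one_self)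
    finally show ?thesis .
  qed
  have "expect (l + Suc j * k) (G (Suc j))
      = (\<Sum>xs\<in>words (l + j * k). \<Sum>ys\<in>words k. \<mu> (xs @ ys) * G (Suc j) (xs @ ys))"
    using sum_words_add[of "\<lambda>zs. \<mu> zs * G (Suc j) zs" "l + j * k" k]
    by (simp add: expect_def algebra_simps)
  also have "\<dots> = (\<Sum>xs\<in>words (l + j * k). G j xs * (\<Sum>ys\<in>words k. \<mu> (xs @ ys) * exp (- of_bool (ys = u))))"
    by (intro sum.cong refl) (simp add: G sum_distrib_left mult_ac)
  also have "\<dots> \<le> (\<Sum>xs\<in>words (l + j * k). G j xs * (\<mu> xs * exp (- (\<theta> / 2))))"
    by (intro sum_mono mult_left_mono inner) (simp add: G_def)
  also have "\<dots> = exp (- (\<theta> / 2)) * expect (l + j * k) (G j)"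
    by (simp add: expect_def sum_distrib_left mult_ac)
  also have "\<dots> \<le> exp (- (\<theta> / 2)) * exp (- (j * (\<theta> / 2)))"
    by (rule mult_left_mono) (use Suc in \<open>simp_all add: G_def[abs_def] \<theta>_def del: sum_of_bool_eq\<close>)
  also have "\<dots> = exp (- (Suc j * (\<theta> / 2)))"
    by (simp add: exp_add[symmetric] algebra_simps add_divide_distrib)
  finally show ?case by (simp only: G_def[abs_def] \<theta>_def)
qed

text \<open>
  An occurrence in window \<open>i\<close> ends at position \<open>d + i k\<close>, and these are distinct counted times. The
  first window starts \<open>k\<close> symbols before counting begins, so \<open>j\<close> windows and the symbol that follows
  the last of them fit into a sample of length \<open>d + (j - 1) k + 1\<close>.
\<close>

lemma windows_le_count_word:
  fixes u :: "'a list"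
  assumes k: "length u = k" "1 \<le> k" "k \<le> d" and j: "d + j * k < length xs + k"
  shows "(\<Sum>i<j. of_bool (take k (drop (d - k + i * k) xs) = u)) \<le> count_word d xs u"
proof -
  have b: "d + i * k < length xs" if "i < j" for i
  proof -
    have "i * k + k \<le> j * k" using that mult_le_mono1[of "Suc i" j k] by simp
    then show ?thesis using j by linarith
  qed
  have inj: "inj_on (\<lambda>i. d + i * k) {..<j}" using k by (auto simp: inj_on_def)
  have "(\<Sum>i<j. of_bool (take k (drop (d - k + i * k) xs) = u))
      \<le> (\<Sum>i<j. of_bool (suffix u (take (d + i * k) xs)) :: nat)"
  proof (rule sum_mono)
    fix i assume "i \<in> {..<j}"
    have "take k (drop (d - k + i * k) xs) = drop (d - k + i * k) (take (d + i * k) xs)"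
      using k by (simp add: take_drop)
    moreover have "suffix (drop (d - k + i * k) (take (d + i * k) xs)) (take (d + i * k) xs)"
      by (rule suffix_drop)
    ultimately show "of_bool (take k (drop (d - k + i * k) xs) = u)
        \<le> (of_bool (suffix u (take (d + i * k) xs)) :: nat)" by auto
  qed
  also have "\<dots> = (\<Sum>t\<in>(\<lambda>i. d + i * k) ` {..<j}. of_bool (suffix u (take t xs)))"
    using inj by (simp add: sum.reindex del: sum_of_bool_eq)
  also have "\<dots> \<le> (\<Sum>t\<in>{d..<length xs}. of_bool (suffix u (take t xs)))"
    by (rule sum_mono2) (use b in auto)
  also have "\<dots> = count_word d xs u" using count_word_eq[of u d xs] k by simp
  finally show ?thesis .
qed

text \<open>
  There are at least \<open>(n - d) / k\<close> disjoint windows. With \<open>c\<close> the claimed bound and \<open>S\<close> the number of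
  windows filled by \<open>u\<close>, Markov's inequality for \<open>exp (- S)\<close>, whose mean is at most \<open>exp (- 2 c)\<close>,
  leaves \<open>exp (- c)\<close>.
\<close>

lemma pr_count_word_small:
  fixes u :: "'a list"
  assumes low: "\<And>xs a. \<mu> (xs @ [a]) \<ge> \<alpha> * \<mu> xs" "0 \<le> \<alpha>" "\<alpha> \<le> 1"
    and k: "length u = k" "1 \<le> k" "k \<le> d" and n: "d < n"
  shows "pr n (\<lambda>xs. count_word d xs u \<le> real (n - d) * \<alpha> ^ k / (4 * k))
    \<le> exp (- (real (n - d) * \<alpha> ^ k / (4 * k)))"
proof -
  \<comment> \<open>\<open>j\<close> is \<open>(n - d) / k\<close> rounded up\<close>
  define j where "j = (n - d - 1) div k + 1"
  define S where "S xs = (\<Sum>i<j. of_bool (take k (drop (d - k + i * k) xs) = u) :: nat)" for xs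
  define c where "c = real (n - d) * \<alpha> ^ k / (4 * k)"
  have "(n - d - 1) div k * k \<le> n - d - 1" by (rule div_times_less_eq_dividend)
  moreover have "j * k = (n - d - 1) div k * k + k" by (simp add: j_def)
  ultimately have jn: "d + j * k < n + k" using n by linarith
  then have jn': "d - k + j * k \<le> n" using k by linarith
  have "n - d - 1 < ((n - d - 1) div k + 1) * k"
    using k dividend_less_div_times[of k "n - d - 1"] by (simp add: algebra_simps)
  then have "n - d \<le> j * k" using n by (simp add: j_def)
  then have "real (n - d) \<le> real j * real k" by (metis of_nat_le_iff of_nat_mult)
  then have jk: "real (n - d) / k \<le> j" using k by (simp add: divide_le_eq)
  have c2: "2 * c \<le> j * (\<alpha> ^ k / 2)"
    using mult_right_mono[OF jk, of "\<alpha> ^ k / 2"] low k by (simp add: c_def field_simps)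
  have St: "S xs = S (take (d - k + j * k) xs)" for xs
    unfolding S_def
  proof (intro sum.cong refl arg_cong[where f = of_bool])
    fix i assume "i \<in> {..<j}"
    then have "i * k + k \<le> j * k" using mult_le_mono1[of "Suc i" j k] by simp
    then show "(take k (drop (d - k + i * k) xs) = u) =
        (take k (drop (d - k + i * k) (take (d - k + j * k) xs)) = u)"
      by (simp add: drop_take min_def)
  qed
  have "pr n (\<lambda>xs. count_word d xs u \<le> c) \<le> expect n (\<lambda>xs. exp (- real (S xs))) / exp (- c)"
  proof (rule pr_markov)
    fix xs assume xs: "length xs = n" "count_word d xs u \<le> c"
    have "S xs \<le> count_word d xs u"
      unfolding S_def by (rule windows_le_count_word) (use k jn xs in auto)
    then have "real (S xs) \<le> real (count_word d xs u)" by (rule of_nat_mono)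
    then have "real (S xs) \<le> c" using xs(2) by linarith
    then show "exp (- c) \<le> exp (- real (S xs))" by simp
  qed auto
  also have "expect n (\<lambda>xs. exp (- real (S xs))) = expect n (\<lambda>xs. exp (- real (S (take (d - k + j * k) xs))))"
    by (simp only: St[symmetric])
  also have "\<dots> = expect (d - k + j * k) (\<lambda>xs. exp (- real (S xs)))"
    by (rule expect_take[OF jn'])
  also have "\<dots> \<le> exp (- (j * (\<alpha> ^ k / 2)))"
    using expect_windows[OF low k(1), of "d - k" j] unfolding S_def by (simp del: sum_of_bool_eq)
  also have "\<dots> \<le> exp (- (2 * c))" using c2 by simp
  finally have "pr n (\<lambda>xs. count_word d xs u \<le> c) \<le> exp (- (2 * c)) / exp (- c)"
    by (simp add: divide_right_mono)
  also have "\<dots> = exp (- c)" by (simp add: exp_diff[symmetric])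
  finally show ?thesis by (simp add: c_def)
qed

text \<open>
  The exponential is a supermartingale: at a time when \<open>u\<close> has just occurred, the factor
  \<open>exp (\<tau> (1\<^sub>a - \<beta>))\<close> has conditional mean at most \<open>1 + \<tau>\<^sup>2 \<le> exp (\<tau>\<^sup>2)\<close> by
  \<open>exp_le_quadratic\<close> and the drift assumption; at other times nothing changes. The sign of \<open>\<tau>\<close>
  selects upper or lower deviations.
\<close>

lemma expect_exp_deviation:
  fixes u :: "'a list" and \<tau> \<beta> :: real
  assumes u: "length u \<le> d" and lam: "\<bar>\<tau>\<bar> \<le> 1" and beta: "0 \<le> \<beta>" "\<beta> \<le> 1"
    and drift: "\<And>xs. suffix u xs \<Longrightarrow> \<tau> * \<mu> (xs @ [a]) \<le> \<tau> * (\<beta> * \<mu> xs)"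
  shows "expect n (\<lambda>xs. exp (\<tau> * (count_next d xs u a - \<beta> * count_word d xs u) - \<tau>\<^sup>2 * count_word d xs u)) \<le> 1"
proof (induction n)
  case 0
  have "words 0 = {[] :: 'a list}" by auto
  moreover have "count_next d [] u b = 0" for b by (simp add: count_next_eq[OF u])
  ultimately show ?case by (simp add: expect_def nil count_word_def)
next
  case (Suc n)
  define F where "F xs = exp (\<tau> * (count_next d xs u a - \<beta> * count_word d xs u) - \<tau>\<^sup>2 * count_word d xs u)" for xs
  have step: "(\<Sum>b\<in>UNIV. \<mu> (xs @ [b]) * F (xs @ [b])) \<le> \<mu> xs * F xs" for xs
  proof (cases "d \<le> length xs \<and> suffix u xs")
    case False
    then have "F (xs @ [b]) = F xs" for b
      by (auto simp: F_def count_next_snoc[OF u] count_word_snoc[OF u])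
    then show ?thesis by (simp add: sum_distrib_right[symmetric] snoc)
  next
    case True
    define y where "y b = \<tau> * (of_bool (b = a) - \<beta>)" for b
    have F: "F (xs @ [b]) = F xs * exp (- \<tau>\<^sup>2) * exp (y b)" for b
      using True
      by (simp add: F_def y_def count_next_snoc[OF u] count_word_snoc[OF u] exp_add[symmetric] algebra_simps)
    have yb: "\<bar>y b\<bar> \<le> \<bar>\<tau>\<bar>" for b
    proof -
      have "\<bar>y b\<bar> = \<bar>\<tau>\<bar> * \<bar>of_bool (b = a) - \<beta>\<bar>" by (simp add: y_def abs_mult)
      also have "\<dots> \<le> \<bar>\<tau>\<bar> * 1" using beta by (intro mult_left_mono) auto
      finally show ?thesis by simp
    qed
    have e: "exp (y b) \<le> 1 + y b + \<tau>\<^sup>2" for b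
    proof -
      have "exp (y b) \<le> 1 + y b + (y b)\<^sup>2"
        using yb[of b] lam by (intro exp_le_quadratic) simp
      also have "(y b)\<^sup>2 \<le> \<tau>\<^sup>2" using yb[of b] by (simp add: abs_le_square_iff)
      finally show ?thesis by simp
    qed
    have "(\<Sum>b\<in>UNIV. \<mu> (xs @ [b]) * exp (y b)) \<le> (\<Sum>b\<in>UNIV. \<mu> (xs @ [b]) * (1 + y b + \<tau>\<^sup>2))"
      by (intro sum_mono mult_left_mono e nonneg)
    also have "\<dots> = (\<Sum>b\<in>UNIV. \<mu> (xs @ [b]) * (1 + \<tau>\<^sup>2 - \<tau> * \<beta>) + (if b = a then \<tau> * \<mu> (xs @ [a]) else 0))"
      by (intro sum.cong refl) (auto simp: y_def algebra_simps)
    also have "\<dots> = \<mu> xs * (1 + \<tau>\<^sup>2 - \<tau> * \<beta>) + \<tau> * \<mu> (xs @ [a])"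
      by (simp add: sum.distrib sum_distrib_right[symmetric] snoc)
    also have "\<dots> \<le> \<mu> xs * (1 + \<tau>\<^sup>2)"
      using drift[of xs] True by (simp add: algebra_simps)
    also have "\<dots> \<le> \<mu> xs * exp (\<tau>\<^sup>2)"
      by (intro mult_left_mono nonneg exp_ge_add_one_self)
    finally have "F xs * exp (- \<tau>\<^sup>2) * (\<Sum>b\<in>UNIV. \<mu> (xs @ [b]) * exp (y b))
        \<le> F xs * exp (- \<tau>\<^sup>2) * (\<mu> xs * exp (\<tau>\<^sup>2))"
      by (rule mult_left_mono) (simp add: F_def)
    moreover have "F xs * exp (- \<tau>\<^sup>2) * (\<mu> xs * exp (\<tau>\<^sup>2)) = \<mu> xs * F xs"
      by (simp add: exp_minus)
    moreover have "(\<Sum>b\<in>UNIV. \<mu> (xs @ [b]) * F (xs @ [b]))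
        = F xs * exp (- \<tau>\<^sup>2) * (\<Sum>b\<in>UNIV. \<mu> (xs @ [b]) * exp (y b))"
      by (simp add: F sum_distrib_left mult_ac)
    ultimately show ?thesis by simp
  qed
  have "expect (Suc n) F \<le> expect n F"
    unfolding expect_Suc by (unfold expect_def) (intro sum_mono step)
  then show ?case using Suc by (simp add: F_def[abs_def])
qed

text \<open>
  Exponential Markov inequality with \<open>\<tau> = s z / (2 (n - d))\<close>, the minimizer of
  \<open>(n - d) \<tau>\<^sup>2 - \<bar>\<tau>\<bar> z\<close>; it is admissible as long as \<open>z \<le> n - d\<close>. Larger deviations never occur,
  since \<open>u\<close> is counted at most \<open>n - d\<close> times.
\<close>

lemma pr_deviation:
  fixes u :: "'a list" and s z \<beta> :: real
  assumes u: "length u \<le> d" "d < n" and s: "s = 1 \<or> s = - 1" and z: "z \<ge> 0" and beta: "0 \<le> \<beta>" "\<beta> \<le> 1"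
    and drift: "\<And>xs. suffix u xs \<Longrightarrow> s * \<mu> (xs @ [a]) \<le> s * (\<beta> * \<mu> xs)"
  shows "pr n (\<lambda>xs. s * (count_next d xs u a - \<beta> * count_word d xs u) \<ge> z)
    \<le> exp (- (z\<^sup>2 / (4 * real (n - d))))"
proof (cases "z \<le> real (n - d)")
  case False
  have "\<not> s * (count_next d xs u a - \<beta> * count_word d xs u) \<ge> z" if "length xs = n" for xs
  proof -
    have m: "real (count_word d xs u) \<le> real (n - d)"
      using count_word_le[OF u(1), of xs] that by simp
    have "0 \<le> \<beta> * count_word d xs u" "\<beta> * count_word d xs u \<le> count_word d xs u"
      using beta by (auto intro: mult_left_le_one_le)
    moreover have "real (count_next d xs u a) \<le> count_word d xs u"
      using count_next_le_word by (rule of_nat_mono)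
    ultimately have "s * (count_next d xs u a - \<beta> * count_word d xs u) \<le> count_word d xs u"
      using s by auto
    then show ?thesis using m False by linarith
  qed
  then have "pr n (\<lambda>xs. s * (count_next d xs u a - \<beta> * count_word d xs u) \<ge> z) \<le> pr n (\<lambda>xs. False)"
    by (intro pr_mono) auto
  then show ?thesis by (rule order_trans) (simp add: pr_def expect_def)
next
  case True
  define m where "m = real (n - d)"
  have m: "m > 0" using u by (simp add: m_def)
  define \<tau> where "\<tau> = s * (z / (2 * m))"
  have zm: "0 \<le> z / (2 * m)" "z / (2 * m) \<le> 1" using True m z by (auto simp: m_def[symmetric] field_simps)
  have lam: "\<bar>\<tau>\<bar> \<le> 1" using s zm by (auto simp: \<tau>_def abs_mult)
  have lam2: "\<tau>\<^sup>2 = (z / (2 * m))\<^sup>2" using s by (auto simp: \<tau>_def power_mult_distrib)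
  have dr: "\<tau> * \<mu> (xs @ [a]) \<le> \<tau> * (\<beta> * \<mu> xs)" if "suffix u xs" for xs
    using mult_left_mono[OF drift[OF that] zm(1)] by (simp add: \<tau>_def mult_ac)
  have "pr n (\<lambda>xs. s * (count_next d xs u a - \<beta> * count_word d xs u) \<ge> z)
      \<le> expect n (\<lambda>xs. exp (\<tau> * (count_next d xs u a - \<beta> * count_word d xs u) - \<tau>\<^sup>2 * count_word d xs u))
        / exp (z\<^sup>2 / (4 * m))"
  proof (rule pr_markov)
    fix xs assume xs: "length xs = n" and dev: "z \<le> s * (count_next d xs u a - \<beta> * count_word d xs u)"
    have N: "real (count_word d xs u) \<le> m"
      using count_word_le[OF u(1), of xs] xs by (simp add: m_def)
    have "z\<^sup>2 / (4 * m) = z / (2 * m) * z - \<tau>\<^sup>2 * m"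
      unfolding lam2 using m by (simp add: field_simps power2_eq_square)
    also have "\<dots> \<le> z / (2 * m) * (s * (count_next d xs u a - \<beta> * count_word d xs u)) - \<tau>\<^sup>2 * count_word d xs u"
      by (intro diff_mono mult_left_mono dev N zm(1)) simp
    also have "\<dots> = \<tau> * (count_next d xs u a - \<beta> * count_word d xs u) - \<tau>\<^sup>2 * count_word d xs u"
      by (simp add: \<tau>_def mult_ac)
    finally show "exp (z\<^sup>2 / (4 * m)) \<le> exp (\<tau> * (count_next d xs u a - \<beta> * count_word d xs u) - \<tau>\<^sup>2 * count_word d xs u)"
      by simp
  qed auto
  also have "\<dots> \<le> 1 / exp (z\<^sup>2 / (4 * m))"
    by (intro divide_right_mono expect_exp_deviation) (use u lam beta dr in auto)
  finally show ?thesis by (simp add: exp_minus m_def field_simps)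
qed

end

section \<open>The process and its word probabilities\<close>

definition cylinder :: "'b measure \<Rightarrow> (int \<Rightarrow> 'b \<Rightarrow> 'a) \<Rightarrow> int \<Rightarrow> 'a list \<Rightarrow> 'b set"
  where "cylinder M X m w = {\<omega>\<in>space M. \<forall>i<length w. X (m + int i) \<omega> = w ! i}"

lemma block_eq_iff:
  "block X m (m + int (length w) - 1) \<omega> = w \<longleftrightarrow> (\<forall>i<length w. X (m + int i) \<omega> = w ! i)"
  unfolding block_def list_eq_iff_nth_eq by (simp add: nth_upto)

lemma length_block [simp]: "length (block X 1 (int n) \<omega>) = n"
  by (simp add: block_def)

lemma recent_past: "recent (past X \<omega>) k = block X (- int k) (- 1) \<omega>"
  by (rule nth_equalityI) (simp_all add: recent_nth past_def block_def nth_upto of_nat_diff)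

locale process =
  fixes M :: "'b measure"
    and X :: "int \<Rightarrow> 'b \<Rightarrow> 'a::finite"
    and q :: "(nat \<Rightarrow> 'a) \<Rightarrow> 'a \<Rightarrow> real"
  assumes stationary_ergodic: "stationary_ergodic_process M X"
    and version: "past_version M X q"
begin

sublocale prob_space M
  using stationary_ergodic by (simp add: stationary_ergodic_process_def)

lemma X_measurable [measurable]: "X t \<in> measurable M (count_space UNIV)"
  using stationary_ergodic by (simp add: stationary_ergodic_process_def)

lemma cylinder_sets [measurable]: "cylinder M X m w \<in> sets M"
  unfolding cylinder_def by measurable

lemma cylinder_subset_space: "cylinder M X m w \<subseteq> space M"
  by (auto simp: cylinder_def)

lemma word_prob_eq_cylinder_1: "word_prob M X w = prob (cylinder M X 1 w)"
  using block_eq_iff[of X 1 w] by (simp add: word_prob_def cylinder_def)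

text \<open>
  Stationarity is given for a shift by one step; induction on the integers gives all shifts.
\<close>

lemma prob_cylinder: "prob (cylinder M X m w) = word_prob M X w"
proof -
  define C where "C m = {x \<in> space (path_space TYPE(int)). \<forall>i<length w. x (m + int i) = w ! i}" for m
  have Csets: "C m \<in> sets (path_space TYPE(int))" for m
    unfolding C_def by measurable
  have meas: "(\<lambda>\<omega> t. X (t + s) \<omega>) \<in> measurable M (path_space TYPE(int))" for s
    by (rule measurable_abs_UNIV) measurable
  have step: "prob (cylinder M X (m + 1) w) = prob (cylinder M X m w)" for m
  proof -
    have "prob (cylinder M X (m + 1) w) = measure (distr M (path_space TYPE(int)) (\<lambda>\<omega> t. X (t + 1) \<omega>)) (C m)"
      by (subst measure_distr[OF meas Csets])
        (auto simp: C_def cylinder_def space_PiM ac_simps intro!: arg_cong[where f = prob])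
    also have "\<dots> = measure (distr M (path_space TYPE(int)) (\<lambda>\<omega> t. X t \<omega>)) (C m)"
      using stationary_ergodic by (simp add: stationary_ergodic_process_def stationary_def)
    also have "\<dots> = prob (cylinder M X m w)"
      using meas[of 0] by (subst measure_distr[OF _ Csets])
        (auto simp: C_def cylinder_def space_PiM ac_simps intro!: arg_cong[where f = prob])
    finally show ?thesis .
  qed
  have "prob (cylinder M X m w) = prob (cylinder M X 1 w)"
  proof (induction m rule: int_induct[where k = 1])
    case (step2 i)
    then show ?case using step[of "i - 1"] by simp
  qed (simp_all add: step)
  then show ?thesis by (simp add: word_prob_eq_cylinder_1)
qed

lemma cylinder_snoc:
  "cylinder M X m (w @ [a]) = cylinder M X m w \<inter> {\<omega>\<in>space M. X (m + int (length w)) \<omega> = a}"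
  by (auto simp: cylinder_def nth_append less_Suc_eq)

sublocale word_law "word_prob M X"
proof
  show "word_prob M X xs \<ge> 0" for xs by (simp add: word_prob_def)
  show "word_prob M X [] = 1" by (simp add: word_prob_eq_cylinder_1 cylinder_def prob_space)
  fix xs :: "'a list"
  have "(\<Union>a\<in>UNIV. cylinder M X 1 (xs @ [a])) = cylinder M X 1 xs"
    using cylinder_subset_space[of 1 xs] by (auto simp: cylinder_snoc)
  moreover have "prob (\<Union>a\<in>UNIV. cylinder M X 1 (xs @ [a])) = (\<Sum>a\<in>UNIV. prob (cylinder M X 1 (xs @ [a])))"
    by (rule finite_measure_finite_Union) (auto simp: disjoint_family_on_def cylinder_snoc)
  ultimately show "(\<Sum>a\<in>UNIV. word_prob M X (xs @ [a])) = word_prob M X xs"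
    by (simp add: word_prob_eq_cylinder_1)
qed

lemma prob_sample: "prob {\<omega>\<in>space M. Q (block X 1 (int n) \<omega>)} = pr n Q"
proof -
  \<comment> \<open>\<open>Q\<close> holds on the disjoint union of the cylinders of the words that satisfy it\<close>
  have cyl: "cylinder M X 1 w = {\<omega>\<in>space M. block X 1 (int n) \<omega> = w}" if "length w = n" for w
    using block_eq_iff[of X 1 w] that by (simp add: cylinder_def)
  define W where "W = {w. length w = n \<and> Q w}"
  have fin: "finite W" by (rule finite_subset[OF _ finite_words[of n]]) (auto simp: W_def)
  have "{\<omega>\<in>space M. Q (block X 1 (int n) \<omega>)} = (\<Union>w\<in>W. cylinder M X 1 w)"
    by (auto simp: W_def cyl)
  also have "prob \<dots> = (\<Sum>w\<in>W. prob (cylinder M X 1 w))"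
  proof (rule finite_measure_finite_Union[OF fin])
    show "cylinder M X 1 ` W \<subseteq> events" by auto
    show "disjoint_family_on (cylinder M X 1) W"
      by (auto simp: disjoint_family_on_def W_def cyl)
  qed
  also have "\<dots> = (\<Sum>w\<in>words n. word_prob M X w * of_bool (Q w))"
    by (rule sum.mono_neutral_cong_left) (auto simp: W_def finite_words word_prob_eq_cylinder_1)
  finally show ?thesis by (simp add: pr_def expect_def)
qed

lemma trans_prob_Fin: "trans_prob M X q (Fin w) a = word_prob M X (w @ [a]) / word_prob M X w"
proof -
  let ?m = "- int (length w)"
  have "{\<omega>\<in>space M. block X ?m (-1) \<omega> = w} = cylinder M X ?m w"
    using block_eq_iff[of X ?m w] by (auto simp: cylinder_def)
  moreover have "{\<omega>\<in>space M. X 0 \<omega> = a \<and> block X ?m (-1) \<omega> = w} = cylinder M X ?m (w @ [a])"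
    using block_eq_iff[of X ?m w] by (auto simp: cylinder_snoc) (auto simp: cylinder_def)
  ultimately show ?thesis by (simp add: cond_prob_def prob_cylinder)
qed

lemma q_nonneg: "q x a \<ge> 0" and sum_q: "(\<Sum>a\<in>UNIV. q x a) = 1"
  using version by (auto simp: past_version_def)

lemma q_le_1: "q x a \<le> 1"
  using member_le_sum[of a UNIV "q x"] q_nonneg sum_q[of x] by simp

text \<open>
  By stationarity, \<open>\<mu> (w a)\<close> is the probability that \<open>X 0 = a\<close> and that the past ends in \<open>w\<close>. The
  second event is measurable with respect to the past, so this is the integral over it of the
  conditional probability \<open>q\<close>.
\<close>

lemma word_prob_snoc_bounds:
  assumes "\<And>x. recent x (length w) = w \<Longrightarrow> l \<le> q x a \<and> q x a \<le> h"
  shows "l * word_prob M X w \<le> word_prob M X (w @ [a])"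
    and "word_prob M X (w @ [a]) \<le> h * word_prob M X w"
proof -
  define F where "F = vimage_algebra (space M) (past X) (path_space TYPE(nat) :: (nat \<Rightarrow> 'a) measure)"
  define A where "A = {\<omega>\<in>space M. X 0 \<omega> = a}"
  define B where "B = cylinder M X (- int (length w)) w"
  have past: "past X \<in> measurable M (path_space TYPE(nat))"
    unfolding past_def by (rule measurable_abs_UNIV) measurable
  have q_meas: "(\<lambda>x. q x a) \<in> borel_measurable (path_space TYPE(nat))"
    using version by (simp add: past_version_def)
  have sub: "subalgebra M F"
    unfolding subalgebra_def F_def
    using past by (auto simp: sets_vimage_algebra2 space_PiM dest: measurable_sets)
  interpret finite_measure_subalgebra M F
    by standard (rule sub)
  have B_recent: "B = {\<omega>\<in>space M. recent (past X \<omega>) (length w) = w}"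
    using block_eq_iff[of X "- int (length w)" w] by (simp add: B_def cylinder_def recent_past)
  have B_vimage: "B = past X -` {x\<in>space (path_space TYPE(nat)). \<forall>i<length w. x (length w - Suc i) = w ! i} \<inter> space M"
    by (auto simp: B_recent list_eq_iff_nth_eq recent_nth space_PiM)
  have "{x\<in>space (path_space TYPE(nat)). \<forall>i<length w. x (length w - Suc i) = w ! i}
      \<in> sets (path_space TYPE(nat) :: (nat \<Rightarrow> 'a) measure)"
    by measurable
  then have BF: "B \<in> sets F" unfolding F_def B_vimage by (rule in_vimage_algebra)
  have BM: "B \<in> sets M" by (simp add: B_def)
  have AM: "A \<in> sets M" unfolding A_def by measurable
  have ce: "AE \<omega> in M. real_cond_exp M F (indicator A) \<omega> = q (past X \<omega>) a"
    using version by (simp add: past_version_def F_def A_def)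
  have "word_prob M X (w @ [a]) = prob (B \<inter> A)"
    using prob_cylinder[of "- int (length w)" "w @ [a]"] by (simp add: cylinder_snoc B_def A_def)
  also have "\<dots> = (\<integral>\<omega>\<in>B. indicator A \<omega> \<partial>M)"
    using AM BM by (simp add: set_lebesgue_integral_def indicator_inter_arith[symmetric])
  also have "\<dots> = (\<integral>\<omega>\<in>B. real_cond_exp M F (indicator A) \<omega> \<partial>M)"
    by (rule real_cond_exp_intA[OF _ BF]) (use AM in \<open>simp add: integrable_indicator_iff less_top[symmetric]\<close>)
  also have "\<dots> = (\<integral>\<omega>\<in>B. q (past X \<omega>) a \<partial>M)"
    unfolding set_lebesgue_integral_def
    by (rule integral_cong_AE)
      (use ce BM measurable_compose[OF past q_meas] in \<open>auto intro: borel_measurable_cond_exp2\<close>)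
  finally have eq: "word_prob M X (w @ [a]) = (\<integral>\<omega>. indicator B \<omega> * q (past X \<omega>) a \<partial>M)"
    by (simp add: set_lebesgue_integral_def)
  have const: "(\<integral>\<omega>. indicator B \<omega> * c \<partial>M) = c * word_prob M X w" for c :: real
    using BM by (simp add: prob_cylinder B_def)
  have int: "integrable M (\<lambda>\<omega>. indicator B \<omega> * q (past X \<omega>) a)"
    using measurable_compose[OF past q_meas] BM q_nonneg q_le_1
    by (intro integrable_const_bound[where B = 1]) (auto simp: indicator_def)
  have intc: "integrable M (\<lambda>\<omega>. indicator B \<omega> * c)" for c :: real
    using BM by (intro integrable_mult_left integrable_real_indicator) (auto simp: less_top[symmetric])
  show "l * word_prob M X w \<le> word_prob M X (w @ [a])"
    unfolding eq const[symmetric]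
    by (intro integral_mono int intc) (use assms in \<open>auto simp: B_recent indicator_def\<close>)
  show "word_prob M X (w @ [a]) \<le> h * word_prob M X w"
    unfolding eq const[symmetric]
    by (intro integral_mono int intc) (use assms in \<open>auto simp: B_recent indicator_def\<close>)
qed

abbreviation \<open>T0 \<equiv> context_tree M X q\<close>
abbreviation \<open>p \<equiv> trans_prob M X q\<close>

lemma p_nonneg: "p w a \<ge> 0"
  by (cases w) (auto simp: trans_prob_Fin q_nonneg nonneg simp del: trans_prob.simps(1))

lemma is_context_p_eq:
  assumes "is_context M X q s" "recent x (length s) = s"
  shows "p (Fin s) a = q x a"
  using assms by (simp add: is_context_def determines_next_def del: trans_prob.simps(1))

text \<open>
  Every past is represented in the context tree, by a context that it ends in or by itself. In either
  case that node has the conditional law \<open>q x\<close>.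
\<close>

lemma context_of_past:
  obtains (finite_context) s where "is_context M X q s" "recent x (length s) = s"
  | (infinite) "SemiInf x \<in> T0"
proof (cases "infinite_context M X q x")
  case True
  then show ?thesis using infinite by (simp add: context_tree_def)
next
  case False
  then obtain s where "s = recent x (length s)" "is_context M X q s"
    by (auto simp: infinite_context_def)
  then show ?thesis using finite_context by metis
qed

lemma alpha_0_le_p: "w \<in> T0 \<Longrightarrow> alpha M X q 0 \<le> p w a"
proof -
  assume "w \<in> T0"
  moreover have "bdd_below ((\<lambda>(w, a). p w a) ` (T0 \<times> UNIV))"
    by (rule bdd_belowI[of _ 0]) (auto simp: p_nonneg simp del: trans_prob.simps)
  ultimately have "(INF (w, a) \<in> T0 \<times> UNIV. p w a) \<le> (\<lambda>(w, a). p w a) (w, a)"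
    by (intro cINF_lower) auto
  then show ?thesis by (simp add: alpha_def Let_def)
qed

lemma alpha_0_le_q: "alpha M X q 0 \<le> q x a"
proof (cases rule: context_of_past[of x])
  case (finite_context s)
  then have "Fin s \<in> T0" by (simp add: context_tree_def)
  then show ?thesis using alpha_0_le_p is_context_p_eq[OF finite_context] by metis
next
  case infinite
  then show ?thesis using alpha_0_le_p[OF infinite, of a] by simp
qed

lemma word_prob_snoc_ge: "alpha M X q 0 * word_prob M X w \<le> word_prob M X (w @ [a])"
  by (rule word_prob_snoc_bounds(1)[where h = 1]) (simp add: alpha_0_le_q q_le_1)

text \<open>
  If a context of length at most \<open>k\<close> is a suffix of one of the pasts, it is a suffix of both and \<open>q\<close>
  agrees on them. Otherwise both are represented in the context tree below \<open>u\<close>, the common last \<open>k\<close>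
  symbols. Each \<open>q (.) b\<close> is then at least the infimum \<open>I b\<close> below \<open>u\<close>, and these infima sum up to at
  least \<open>\<alpha>\<^sub>k\<close>; hence \<open>q x a = 1 - (\<Sum>b\<noteq>a. q x b) \<le> 1 - \<alpha>\<^sub>k + I a\<close>.
\<close>

lemma q_diff_le:
  assumes k: "k \<ge> 1" and xy: "recent x k = recent y k"
  shows "q x a - q y a \<le> \<bar>1 - alpha M X q k\<bar>"
proof (cases "\<exists>s. length s \<le> k \<and> is_context M X q s \<and> recent x (length s) = s")
  case True
  then obtain s where s: "length s \<le> k" "is_context M X q s" "recent x (length s) = s" by blast
  then have "suffix s (recent y k)" using suffix_recent_iff[of s k x] xy by simp
  then have "recent y (length s) = s" using suffix_recent_iff[of s k y] s by simp
  then show ?thesis using is_context_p_eq[OF s(2)] s(3) by (metis abs_ge_zero diff_self)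
next
  case False
  define u where "u = recent x k"
  define I where "I b = (INF w\<in>{w\<in>T0. proper_suffix (Fin u) w}. p w b)" for b
  \<comment> \<open>a past ending in \<open>u\<close> is represented strictly below \<open>u\<close>\<close>
  have node: "\<exists>w\<in>T0. proper_suffix (Fin u) w \<and> (\<forall>b. p w b = q z b)" if z: "recent z k = u" for z
  proof (cases rule: context_of_past[of z])
    case (finite_context s)
    have "length s > k"
    proof (rule ccontr)
      assume "\<not> length s > k"
      then have "length s \<le> k" by simp
      then have "recent x (length s) = s"
        using suffix_recent_iff[of s k x] suffix_recent_iff[of s k z] finite_context z by (simp add: u_def)
      then show False using False finite_context \<open>length s \<le> k\<close> by blast
    qed
    then have "suffix u s"
      using suffix_recent_iff[of u "length s" z] finite_context z by (simp add: u_def)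
    then have "proper_suffix (Fin u) (Fin s)"
      using \<open>length s > k\<close> by (auto simp: strict_suffix_def u_def)
    moreover have "Fin s \<in> T0" using finite_context by (simp add: context_tree_def)
    ultimately show ?thesis using is_context_p_eq[OF finite_context] by blast
  next
    case infinite
    have "proper_suffix (Fin u) (SemiInf z)" using z by (simp add: u_def)
    then show ?thesis using infinite by (intro bexI[of _ "SemiInf z"]) auto
  qed
  have ex: "\<exists>w\<in>T0. proper_suffix (Fin u) w" using node[of x] by (auto simp: u_def)
  have Ile: "I b \<le> q z b" if z: "recent z k = u" for z b
  proof -
    obtain w where w: "w \<in> T0" "proper_suffix (Fin u) w" "p w b = q z b" using node[OF z] by blast
    have "I b \<le> p w b" unfolding I_def
      by (rule cINF_lower[OF bdd_belowI[of _ 0]]) (use w p_nonneg in auto)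
    then show ?thesis using w by simp
  qed
  define g where "g v = (if \<exists>w\<in>T0. proper_suffix (Fin v) w
      then (\<Sum>a\<in>UNIV. INF w \<in> {w\<in>T0. proper_suffix (Fin v) w}. p w a) else 1)" for v
  have "alpha M X q k = (INF v\<in>words k. g v)"
    using k by (simp add: alpha_def Let_def g_def)
  also have "\<dots> \<le> g u"
    by (rule cINF_lower) (auto simp: u_def finite_words)
  also have "\<dots> = (\<Sum>b\<in>UNIV. I b)" using ex by (simp add: g_def I_def)
  also have "\<dots> = I a + (\<Sum>b\<in>UNIV - {a}. I b)" by (simp add: sum.remove)
  also have "\<dots> \<le> q y a + (\<Sum>b\<in>UNIV - {a}. q x b)"
    using Ile[of x] Ile[of y] xy by (intro add_mono sum_mono) (auto simp: u_def)
  also have "(\<Sum>b\<in>UNIV - {a}. q x b) = 1 - q x a"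
    using sum_q[of x] by (simp add: sum.remove[of UNIV a])
  finally show ?thesis by simp
qed

text \<open>
  If \<open>q (.) a\<close> were constant on the pasts ending in \<open>w\<close>, its value would be \<open>p(a | w)\<close>, the average of
  \<open>q (.) a\<close> over them.
\<close>

lemma q_varies:
  assumes pos: "word_prob M X w > 0" and nd: "\<not> determines_next M X q w"
  obtains x y a where "recent x (length w) = w" "recent y (length w) = w" "q x a < q y a"
proof -
  obtain x a where x: "recent x (length w) = w" "q x a \<noteq> p (Fin w) a"
    using pos nd unfolding determines_next_def by (metis proper_suffix.simps(2) trans_prob.simps(2))
  have "\<exists>y. recent y (length w) = w \<and> q y a \<noteq> q x a"
  proof (rule ccontr)
    assume "\<nexists>y. recent y (length w) = w \<and> q y a \<noteq> q x a"
    then have "\<And>y. recent y (length w) = w \<Longrightarrow> q x a \<le> q y a \<and> q y a \<le> q x a" by auto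
    then have "word_prob M X (w @ [a]) = q x a * word_prob M X w"
      using word_prob_snoc_bounds[of w "q x a" a "q x a"] by (simp add: antisym)
    then show False using x pos by (simp add: trans_prob_Fin del: trans_prob.simps(1))
  qed
  then obtain y where "recent y (length w) = w" "q y a \<noteq> q x a" by blast
  then show thesis using that x by (metis linorder_neqE)
qed

text \<open>
  Such a \<open>w\<close> is a proper suffix of a node of the context tree. If \<open>w\<close> determined the next symbol, its
  shortest suffix with that property would be a context, but no context is a proper suffix of a node.
\<close>

lemma Int_truncation_not_determined:
  assumes "Fin w \<in> Int_tree (truncation T0 K)"
  shows "\<not> determines_next M X q w" "length w < K"
proof -
  obtain u where u: "u \<in> truncation T0 K" "proper_suffix (Fin w) u"
    using assms by (auto simp: Int_tree_def)
  have "len u \<le> enat K" using u(1) by (auto simp: truncation_def)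
  then obtain s where s: "u = Fin s" "length s \<le> K" by (cases u) auto
  have ws: "strict_suffix w s" using u(2) s by simp
  show "length w < K" using suffix_length_less[of w s] ws s by simp
  have min: "\<exists>v. suffix v w \<and> is_context M X q v" if "determines_next M X q w"
  proof -
    define P where "P v \<longleftrightarrow> suffix v w \<and> determines_next M X q v" for v
    have "P w" using that by (simp add: P_def)
    then obtain v where v: "P v" "\<And>v'. length v' < length v \<Longrightarrow> \<not> P v'"
      using exists_least_iff[of "\<lambda>n. \<exists>v. P v \<and> length v = n"] by metis
    then have "is_context M X q v"
      unfolding is_context_def P_def using suffix_length_less
      by (metis proper_suffix.simps(1) strict_suffix_def suffix_order.trans)
    then show ?thesis using v by (auto simp: P_def)
  qed
  consider "u \<in> T0" | u' where "u' \<in> T0" "proper_suffix u u'"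
    using u(1) by (auto simp: truncation_def)
  then show "\<not> determines_next M X q w"
  proof cases
    case 1
    then have "is_context M X q s" by (auto simp: context_tree_def s)
    then show ?thesis using ws by (auto simp: is_context_def)
  next
    case 2
    show ?thesis
    proof (cases u')
      case (Fin s')
      then have "strict_suffix w s'" "is_context M X q s'"
        using 2 s ws by (auto simp: context_tree_def)
      then show ?thesis by (auto simp: is_context_def)
    next
      case (SemiInf x)
      then have x: "s = recent x (length s)" "infinite_context M X q x"
        using 2 s by (auto simp: context_tree_def)
      show ?thesis
      proof
        assume "determines_next M X q w"
        then obtain v where v: "suffix v w" "is_context M X q v" using min by blast
        then have "suffix v s" using ws suffix_order.trans[of v w s] by (auto simp: strict_suffix_def)
        then have "v = recent x (length v)"
          using suffix_recent_iff[of v "length s" x] x(1) suffix_length_le[of v s] by simp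
        then show False using x(2) v(2) by (simp add: infinite_context_def)
      qed
    qed
  qed
qed

end

context process begin

lemma estimator_minimizes:
  assumes "penalized_likelihood_estimator f d That" "length xs = n" "n \<ge> 1"
  shows "is_arg_min (\<lambda>T. - ln (max_likelihood (d n) xs T) + real (card T) * f n) (feasible (d n) xs) (That xs)"
proof -
  have "xs \<noteq> []" using assms by auto
  then show ?thesis
    using assms by (auto simp: penalized_likelihood_estimator_def)
qed

lemma alpha_0_le_half:
  assumes "CARD('a) \<ge> 2"
  shows "alpha M X q 0 \<le> 1 / 2"
proof -
  have "(\<Sum>a\<in>(UNIV :: 'a set). alpha M X q 0) \<le> (\<Sum>a\<in>UNIV. q undefined a)"
    by (intro sum_mono alpha_0_le_q)
  then have "real CARD('a) * alpha M X q 0 \<le> 1" by (simp add: sum_q)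
  moreover have "2 * alpha M X q 0 \<le> real CARD('a) * alpha M X q 0" if "alpha M X q 0 \<ge> 0"
    using assms that by (intro mult_right_mono) auto
  ultimately show ?thesis by linarith
qed

lemma alpha_0_le_1: "alpha M X q 0 \<le> 1"
  using alpha_0_le_q q_le_1 order_trans by blast

lemma word_prob_pos:
  assumes "alpha M X q 0 > 0"
  shows "word_prob M X w > 0"
proof -
  have "0 < alpha M X q 0 ^ length w * word_prob M X []" using assms by (simp add: nil)
  also have "\<dots> \<le> word_prob M X ([] @ w)"
    by (rule append_ge_power[OF word_prob_snoc_ge]) (use assms in simp)
  finally show ?thesis by simp
qed

section \<open>Underestimation\<close>

text \<open>
  When the counts behave well, the empirical frequencies of \<open>a\<close> after \<open>u1\<close> and \<open>u2\<close> differ by at least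
  \<open>g / 2\<close>: the gap \<open>g\<close> loses \<open>g / 8\<close> at either side to the variation of \<open>q\<close> over pasts with the same
  last \<open>k\<close> symbols, and \<open>g / 8\<close> to random deviation.
\<close>

lemma splitting_gain_le_penalty:
  fixes w :: "'a list" and g N0 c :: real
  assumes min: "is_arg_min (\<lambda>T. - ln (max_likelihood d xs T) + real (card T) * c) (feasible d xs) T"
    and w: "w \<in> T" and k: "length w \<le> k" "k \<le> d"
    and u: "u1 \<in> extensions w k" "u2 \<in> extensions w k"
    and N0: "0 \<le> N0" "\<And>u. length u = k \<Longrightarrow> N0 < count_word d xs u"
    and g: "g > 0" "q2 = q1 + g"
    and dev1: "count_next d xs u1 a - (q1 + g / 8) * count_word d xs u1 < g / 8 * N0"
    and dev2: "(q2 - g / 8) * count_word d xs u2 - count_next d xs u2 a < g / 8 * N0"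
    and c: "c \<ge> 0"
  shows "N0 * g\<^sup>2 / 32 \<le> c * CARD('a) ^ k"
proof -
  have lu: "length u1 = k" "length u2 = k" using u by (auto simp: extensions_def)
  have feas: "feasible d xs T" using min by (simp add: is_arg_min_def)
  have pos: "count_word d xs u \<ge> 1" if "length u = k" for u
    using N0(2)[OF that] N0(1) by linarith
  have r1: "real (count_word d xs u1) > 0" "real (count_word d xs u2) > 0"
    using pos lu by (force intro: Suc_le_lessD)+
  have "count_next d xs u1 a \<le> (q1 + g / 4) * count_word d xs u1"
  proof -
    have "g / 8 * N0 \<le> g / 8 * count_word d xs u1" using N0(2)[OF lu(1)] g by (intro mult_left_mono) auto
    then show ?thesis using dev1 by (simp add: algebra_simps)
  qed
  then have p1: "p_hat d xs u1 a \<le> q1 + g / 4"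
    using r1 by (simp add: p_hat_def divide_le_eq)
  have "count_next d xs u2 a \<ge> (q2 - g / 4) * count_word d xs u2"
  proof -
    have "g / 8 * N0 \<le> g / 8 * count_word d xs u2" using N0(2)[OF lu(2)] g by (intro mult_left_mono) auto
    then show ?thesis using dev2 by (simp add: algebra_simps)
  qed
  then have p2: "q2 - g / 4 \<le> p_hat d xs u2 a"
    using r1 by (simp add: p_hat_def le_divide_eq)
  have R: "\<forall>r\<in>extensions w k. length r \<le> d" "\<forall>r\<in>extensions w k. count_word d xs r \<ge> 1"
    using k pos by (auto simp: extensions_def)
  have "N0 * (g / 2)\<^sup>2 / 8 \<le> (\<Sum>u\<in>extensions w k. log_lik d xs u) - log_lik d xs w"
  proof (rule refinement_gain[OF k u N0(1)])
    show "N0 \<le> count_word d xs u1" "N0 \<le> count_word d xs u2" using N0(2) lu less_imp_le by blast+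
    show "1 \<le> count_word d xs w" using feas w by (simp add: feasible_iff)
    show "0 < g / 2" using g by simp
    show "p_hat d xs u1 a + g / 2 \<le> p_hat d xs u2 a" using p1 p2 g by simp
  qed
  also have "\<dots> \<le> (real (card (extensions w k)) - real (card {w})) * c"
    using arg_min_exchange[OF min _ R cover_extensions[OF k]] w by simp
  also have "\<dots> \<le> real (card (extensions w k)) * c"
    using c by (intro mult_right_mono) auto
  also have "\<dots> \<le> real (CARD('a) ^ k) * c"
    using of_nat_mono[OF card_extensions_le[of w k]] c by (rule mult_right_mono)
  finally show ?thesis by (simp add: power_divide mult_ac)
qed

text \<open>
  The pasts \<open>x\<close> and \<open>y\<close> witness that \<open>w\<close> does not determine the next symbol. Their last \<open>k\<close> symbols,
  for \<open>k\<close> so large that \<open>q\<close> varies by less than an eighth of the gap, are the two extensions.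
  If \<open>w\<close> is selected, then some word of length \<open>k\<close> is rare or the count of \<open>a\<close> after one of the
  two extensions deviates by a fixed fraction of \<open>n - d\<close>; otherwise the gain from splitting would
  exceed the additional penalty as soon as \<open>f(n) / (n - d)\<close> is small.
\<close>

lemma pr_internal_node_selected:
  assumes a0: "alpha M X q 0 > 0"
    and cont: "(\<lambda>k. \<bar>1 - alpha M X q k\<bar>) \<longlonglongrightarrow> 0"
    and xy: "recent x (length w) = w" "recent y (length w) = w" "q x a < q y a"
  shows "\<exists>c1 c2 :: real. c1 > 0 \<and> c2 > 0 \<and> (\<forall>f d That.
    penalizing_term f \<longrightarrow> (\<forall>n\<ge>1. d n < n) \<longrightarrow> filterlim d at_top sequentially \<longrightarrow>
    penalized_likelihood_estimator f d That \<longrightarrow> (\<lambda>m. f m / (real m - real (d m))) \<longlonglongrightarrow> 0 \<longrightarrow>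
    (\<forall>\<^sub>F n in sequentially. pr n (\<lambda>xs. w \<in> That xs) \<le> c1 * exp (- c2 * (real n - real (d n)))))"
proof -
  define a0 where "a0 = alpha M X q 0"
  define g where "g = q y a - q x a"
  have a01: "0 < a0" "a0 \<le> 1" using a0 alpha_0_le_1 by (auto simp: a0_def)
  have g: "0 < g" "g \<le> 1" using xy(3) q_le_1[of y a] q_nonneg[of x a] by (auto simp: g_def)
  have "\<forall>\<^sub>F k in sequentially. \<bar>1 - alpha M X q k\<bar> < g / 8"
    using order_tendstoD(2)[OF cont, of "g / 8"] g by simp
  then have "\<forall>\<^sub>F k in sequentially. \<bar>1 - alpha M X q k\<bar> < g / 8 \<and> Suc (length w) \<le> k"
    by (intro eventually_conj eventually_ge_at_top)
  then obtain k where k: "\<bar>1 - alpha M X q k\<bar> < g / 8" "Suc (length w) \<le> k"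
    by (auto simp: eventually_sequentially)
  define u1 u2 where "u1 = recent x k" and "u2 = recent y k"
  have u: "u1 \<in> extensions w k" "u2 \<in> extensions w k"
    using suffix_recent_iff[of w k] xy k(2) by (auto simp: u1_def u2_def extensions_def)
  have near: "\<bar>q x' a - q z a\<bar> \<le> g / 8" if "suffix (recent z k) xs" "recent x' (length xs) = xs" for x' z xs
  proof -
    have "suffix (recent z k) (recent x' (length xs))" using that by simp
    then have "recent x' k = recent z k"
      using suffix_recent_iff[of "recent z k" "length xs" x'] suffix_length_le[of "recent z k" xs] that(1)
      by simp
    then have "q x' a - q z a \<le> \<bar>1 - alpha M X q k\<bar>" "q z a - q x' a \<le> \<bar>1 - alpha M X q k\<bar>"
      using q_diff_le[of k x' z a] q_diff_le[of k z x' a] k(2) by simp_all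
    then show ?thesis unfolding abs_le_iff using k(1) by linarith
  qed
  define c where "c = a0 ^ k / (4 * k)"
  define c2 where "c2 = min c ((g / 8 * c)\<^sup>2 / 4)"
  have c: "c > 0" using a01 k by (simp add: c_def)
  then have c2: "c2 > 0" using g by (simp add: c2_def)
  define c1 where "c1 = real (CARD('a) ^ k) + 2"
  have c1: "c1 > 0" by (simp add: c1_def add_nonneg_pos)
  have "\<forall>\<^sub>F n in sequentially. pr n (\<lambda>xs. w \<in> That xs) \<le> c1 * exp (- c2 * (real n - real (d n)))"
    if f: "penalizing_term f" and dn: "\<forall>n\<ge>1. d n < n" and d: "filterlim d at_top sequentially"
      and est: "penalized_likelihood_estimator f d That"
      and lim: "(\<lambda>m. f m / (real m - real (d m))) \<longlonglongrightarrow> 0"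
    for f :: "nat \<Rightarrow> real" and d :: "nat \<Rightarrow> nat" and That :: "'a list \<Rightarrow> 'a list set"
  proof -
    \<comment> \<open>below this ratio of \<open>f n\<close> to \<open>n - d n\<close> the penalty of splitting \<open>w\<close> is less than the gain\<close>
    define e where "e = c * g\<^sup>2 / 32 / real (CARD('a) ^ k)"
    have e: "e > 0" using c g by (simp add: e_def)
    have "\<forall>\<^sub>F n in sequentially. f n / (real n - real (d n)) < e"
      using order_tendstoD(2)[OF lim e] .
    moreover have "\<forall>\<^sub>F n in sequentially. k \<le> d n"
      using d by (simp add: filterlim_at_top)
    moreover have "\<forall>\<^sub>F n in sequentially. (1::nat) \<le> n" by (rule eventually_ge_at_top)
    ultimately show ?thesis
    proof eventually_elim
      case (elim n)
      define m where "m = real (n - d n)"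
      have dnn: "d n < n" using dn elim by simp
      then have m: "m > 0" "real n - real (d n) = m" by (auto simp: m_def of_nat_diff)
      define N0 where "N0 = c * m"
      have N0: "N0 > 0" using c m by (simp add: N0_def)
      have f0: "f n > 0" using f by (simp add: penalizing_term_def)
      have small: "f n * real (CARD('a) ^ k) < N0 * g\<^sup>2 / 32"
      proof -
        have "f n < e * m" using elim(1) m by (simp add: divide_less_eq)
        then have "f n * real (CARD('a) ^ k) < e * m * real (CARD('a) ^ k)"
          by (intro mult_strict_right_mono) auto
        also have "\<dots> = N0 * g\<^sup>2 / 32" by (simp add: e_def N0_def)
        finally show ?thesis .
      qed
      let ?B0 = "\<lambda>u xs. real (count_word (d n) xs u) \<le> N0"
      let ?B1 = "\<lambda>xs. 1 * (count_next (d n) xs u1 a - (q x a + g / 8) * count_word (d n) xs u1) \<ge> g / 8 * N0"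
      let ?B2 = "\<lambda>xs. (- 1) * (count_next (d n) xs u2 a - (q y a - g / 8) * count_word (d n) xs u2) \<ge> g / 8 * N0"
      have bad: "(\<exists>u\<in>words k. ?B0 u xs) \<or> ?B1 xs \<or> ?B2 xs" if xs: "length xs = n" "w \<in> That xs" for xs
      proof (rule ccontr)
        assume good: "\<not> ?thesis"
        have "N0 * g\<^sup>2 / 32 \<le> f n * real (CARD('a) ^ k)"
        proof (rule splitting_gain_le_penalty[where ?u1.0 = u1 and ?u2.0 = u2])
          show "is_arg_min (\<lambda>T. - ln (max_likelihood (d n) xs T) + real (card T) * f n) (feasible (d n) xs) (That xs)"
            using estimator_minimizes[OF est xs(1)] elim by simp
          show "q y a = q x a + g" by (simp add: g_def)
        qed (use good xs k elim u N0 g f0 in \<open>auto simp: not_le\<close>)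
        then show False using small by simp
      qed
      have lu: "length u1 = k" "length u2 = k" by (simp_all add: u1_def u2_def)
      have p0: "pr n (?B0 u) \<le> exp (- N0)" if "length u = k" for u
        using pr_count_word_small[OF word_prob_snoc_ge, of u k "d n" n] a01 k elim dnn that
        by (simp add: a0_def[symmetric] N0_def c_def m_def mult_ac)
      have expo: "(g / 8 * N0)\<^sup>2 / (4 * m) = (g / 8 * c)\<^sup>2 / 4 * m"
        using m by (simp add: N0_def power2_eq_square field_simps)
      have z0: "0 \<le> g / 8 * N0" using g N0 by simp
      have b1: "0 \<le> q x a + g / 8" "q x a + g / 8 \<le> 1" and b2: "0 \<le> q y a - g / 8" "q y a - g / 8 \<le> 1"
        using g q_nonneg[of x a] q_le_1[of y a] by (auto simp: g_def field_simps)
      have "pr n ?B1 \<le> exp (- ((g / 8 * N0)\<^sup>2 / (4 * real (n - d n))))"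
      proof (rule pr_deviation[OF _ dnn _ z0 b1])
        show "length u1 \<le> d n" using lu elim by simp
        fix xs assume "suffix u1 xs"
        have up: "q x' a \<le> q x a + g / 8" if "recent x' (length xs) = xs" for x'
        proof -
          have "\<bar>q x' a - q x a\<bar> \<le> g / 8"
            by (rule near) (use that \<open>suffix u1 xs\<close> in \<open>simp_all add: u1_def\<close>)
          then show ?thesis by linarith
        qed
        show "1 * word_prob M X (xs @ [a]) \<le> 1 * ((q x a + g / 8) * word_prob M X xs)"
          using word_prob_snoc_bounds(2)[of xs 0 a] up q_nonneg by simp
      qed simp
      then have p1: "pr n ?B1 \<le> exp (- ((g / 8 * c)\<^sup>2 / 4 * m))"
        unfolding m_def[symmetric] expo .
      have "pr n ?B2 \<le> exp (- ((g / 8 * N0)\<^sup>2 / (4 * real (n - d n))))"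
      proof (rule pr_deviation[OF _ dnn _ z0 b2])
        show "length u2 \<le> d n" using lu elim by simp
        fix xs assume "suffix u2 xs"
        have low: "q y a - g / 8 \<le> q x' a" if "recent x' (length xs) = xs" for x'
        proof -
          have "\<bar>q x' a - q y a\<bar> \<le> g / 8"
            by (rule near) (use that \<open>suffix u2 xs\<close> in \<open>simp_all add: u2_def\<close>)
          then show ?thesis by linarith
        qed
        show "- 1 * word_prob M X (xs @ [a]) \<le> - 1 * ((q y a - g / 8) * word_prob M X xs)"
          using word_prob_snoc_bounds(1)[of xs _ a 1] low q_le_1 by simp
      qed simp
      then have p2: "pr n ?B2 \<le> exp (- ((g / 8 * c)\<^sup>2 / 4 * m))"
        unfolding m_def[symmetric] expo .
      have E0: "exp (- N0) \<le> exp (- (c2 * m))"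
        using m by (simp add: N0_def c2_def mult_right_mono)
      have E1: "exp (- ((g / 8 * c)\<^sup>2 / 4 * m)) \<le> exp (- (c2 * m))"
        using m by (simp add: c2_def mult_right_mono)
      have "pr n (\<lambda>xs. w \<in> That xs) \<le> pr n (\<lambda>xs. (\<exists>u\<in>words k. ?B0 u xs) \<or> ?B1 xs \<or> ?B2 xs)"
        by (rule pr_mono) (use bad in blast)
      also have "\<dots> \<le> pr n (\<lambda>xs. \<exists>u\<in>words k. ?B0 u xs) + (pr n ?B1 + pr n ?B2)"
        by (rule order_trans[OF pr_disj_le]) (intro add_left_mono pr_disj_le)
      also have "pr n (\<lambda>xs. \<exists>u\<in>words k. ?B0 u xs) \<le> (\<Sum>u\<in>words k. pr n (?B0 u))"
        by (rule pr_bex_le[OF finite_words])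
      also have "\<dots> \<le> (\<Sum>u\<in>(words k :: 'a list set). exp (- (c2 * m)))"
        by (rule sum_mono, rule order_trans[OF p0 E0]) simp
      also have "\<dots> = real (CARD('a) ^ k) * exp (- (c2 * m))"
        using card_lists_length_eq[of "UNIV :: 'a set" k] by simp
      also have "pr n ?B1 + pr n ?B2 \<le> 2 * exp (- (c2 * m))"
        using p1 p2 E1 by linarith
      finally show ?case using m by (simp add: c1_def algebra_simps)
    qed
  qed
  then show ?thesis using c1 c2 by blast
qed

section \<open>Overestimation\<close>

text \<open>
  Pruning the branch below \<open>v\<close> saves the penalty of all but one of its at least two leaves, hence at
  least half of it. So the excesses over the law at \<open>v\<close>, summed over the \<open>card S\<close> leaves of the branch,
  amount to at least \<open>card S * (c / 2)\<close>, and one of them is at least \<open>c / 2\<close>.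
\<close>

lemma overestimation_excess:
  fixes c :: real
  assumes A: "CARD('a) \<ge> 2" and a0: "alpha M X q 0 > 0" and c: "c \<ge> 0"
    and min: "is_arg_min (\<lambda>T. - ln (max_likelihood d xs T) + real (card T) * c) (feasible d xs) T"
    and w: "w \<in> T" "strict_suffix v w" and v: "is_context M X q v"
  obtains u where "u \<in> T" "strict_suffix v u" "excess d xs u (p (Fin v)) \<ge> c / 2"
proof -
  have feas: "feasible d xs T" using min by (simp add: is_arg_min_def)
  then have T: "complete_code d T" "\<forall>w\<in>T. count_word d xs w \<ge> 1" by (auto simp: feasible_iff)
  have len: "\<forall>w\<in>T. length w \<le> d" using T by (simp add: complete_code_def)
  define S where "S = {u\<in>T. strict_suffix v u}"
  have S: "S \<subseteq> T" "finite S" "w \<in> S" "\<forall>s\<in>S. length s \<le> d"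
    using finite_bounded_words[OF len] w len by (auto simp: S_def)
  have vd: "length v \<le> d" using w len suffix_length_less[of v w] by fastforce
  have cov: "\<And>z. length z = d \<Longrightarrow> cover S z = cover {v} z"
    unfolding S_def by (rule cover_descendants[OF T(1) w])
  have S2: "card S \<ge> 2" unfolding S_def by (rule card_descendants_ge_2[OF A T(1) w])
  have "count_word d xs w \<le> (\<Sum>s\<in>S. count_word d xs s)"
    by (rule member_le_sum) (use S in auto)
  also have "\<dots> = count_word d xs v"
    using sum_count_next_cong[of "{v}" d S] S vd cov
    unfolding count_word_def by (subst sum.swap) simp
  finally have Nv: "count_word d xs v \<ge> 1" using T(2) w by (meson order_trans)
  let ?r = "p (Fin v)"
  obtain x where x: "recent x (length v) = v" using ex_recent by blast
  have r: "?r = q x" using is_context_p_eq[OF v x] by blast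
  have rpos: "?r b > 0" for b unfolding r using alpha_0_le_q[of x b] a0 by linarith
  have "0 \<le> count_word d xs v / 4 * (p_hat d xs v b - ?r b)\<^sup>2" for b by simp
  also have "\<And>b. \<dots> b \<le> excess d xs v ?r"
    by (rule excess_ge_square) (use rpos in \<open>auto simp: r sum_q q_nonneg simp del: trans_prob.simps(1)\<close>)
  finally have ev: "0 \<le> excess d xs v ?r" .
  have "log_lik d xs v - (\<Sum>s\<in>S. log_lik d xs s) \<le> (1 - real (card S)) * c"
    using arg_min_exchange[OF min S(1), of "{v}"] vd Nv cov by simp
  moreover have "(\<Sum>s\<in>S. excess d xs s ?r) = (\<Sum>s\<in>S. log_lik d xs s) - (log_lik d xs v - excess d xs v ?r)"
    using sum_excess_cover[OF S(4) vd cov, of xs ?r] by (simp add: excess_eq[of d xs v])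
  moreover have "real (card S) * (c / 2) \<le> (real (card S) - 1) * c"
    using mult_right_mono[of 2 "real (card S)" "c / 2"] S2 c by (simp add: algebra_simps)
  ultimately have sum: "(\<Sum>s\<in>S. c / 2) \<le> (\<Sum>s\<in>S. excess d xs s ?r)"
    using ev by (simp add: algebra_simps)
  have "\<exists>u\<in>S. c / 2 \<le> excess d xs u ?r"
  proof (rule ccontr)
    assume "\<not> ?thesis"
    then have "(\<Sum>s\<in>S. excess d xs s ?r) < (\<Sum>s\<in>S. c / 2)"
      using S by (intro sum_strict_mono) (auto simp: not_le)
    then show False using sum by simp
  qed
  then show thesis using that by (auto simp: S_def)
qed

text \<open>
  One symbol contributes at least the average to the chi-square bound.
\<close>

lemma excess_large_imp_deviation:
  fixes r :: "'a \<Rightarrow> real" and \<rho> N0 c :: real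
  assumes r: "\<And>a. r a \<ge> \<rho>" "\<rho> > 0" "(\<Sum>a\<in>UNIV. r a) = 1" and N0: "0 < N0" "N0 < count_word d xs u"
    and ex: "excess d xs u r \<ge> c / 2" and c: "c > 0"
  obtains a s where "s = 1 \<or> s = - 1"
    "s * (count_next d xs u a - r a * count_word d xs u) \<ge> sqrt (c * \<rho> * N0 / (2 * real CARD('a)))"
proof -
  let ?D = "\<lambda>a. count_next d xs u a - r a * count_word d xs u"
  let ?N = "real (count_word d xs u)"
  have rpos: "r a > 0" for a using r(1)[of a] r(2) by linarith
  have "\<exists>a. c / (2 * real CARD('a)) \<le> (?D a)\<^sup>2 / (r a * ?N)"
  proof (rule ccontr)
    assume "\<not> ?thesis"
    then have "(\<Sum>a\<in>UNIV. (?D a)\<^sup>2 / (r a * ?N)) < (\<Sum>a\<in>(UNIV::'a set). c / (2 * real CARD('a)))"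
      by (intro sum_strict_mono) (auto simp: not_le)
    also have "\<dots> = c / 2" by simp
    also have "\<dots> \<le> (\<Sum>a\<in>UNIV. (?D a)\<^sup>2 / (r a * ?N))"
      using ex excess_le_chi_square[of r d xs u, OF rpos r(3)] by linarith
    finally show False by simp
  qed
  then obtain a where a: "c / (2 * real CARD('a)) \<le> (?D a)\<^sup>2 / (r a * ?N)" by blast
  have pos: "r a * ?N > 0" using rpos N0 by simp
  have "c * \<rho> * N0 / (2 * real CARD('a)) = c / (2 * real CARD('a)) * (\<rho> * N0)" by simp
  also have "\<dots> \<le> c / (2 * real CARD('a)) * (r a * ?N)"
    using c r N0 rpos[of a] by (intro mult_left_mono mult_mono) (auto intro: less_imp_le)
  also have "\<dots> \<le> (?D a)\<^sup>2" using a pos by (simp add: le_divide_eq)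
  finally have "sqrt (c * \<rho> * N0 / (2 * real CARD('a))) \<le> sqrt ((?D a)\<^sup>2)"
    by (rule real_sqrt_le_mono)
  then show thesis
    using that[of 1 a] that[of "- 1" a] unfolding real_sqrt_abs by (cases "?D a \<ge> 0") simp_all
qed

lemma card_bounded_words_le:
  assumes "CARD('a) \<ge> 2"
  shows "card {w :: 'a list. length w \<le> d} \<le> 2 * CARD('a) ^ d"
proof -
  have "card {w :: 'a list. length w \<le> d} = (\<Sum>i\<le>d. CARD('a) ^ i)"
    using card_lists_length_le[of "UNIV :: 'a set" d] by simp
  also have "\<dots> \<le> 2 * CARD('a) ^ d"
  proof (induction d)
    case (Suc d)
    have "2 * CARD('a) ^ d \<le> CARD('a) ^ Suc d" using assms by simp
    then show ?case unfolding sum.atMost_Suc using Suc by linarith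
  qed simp
  finally show ?thesis .
qed

text \<open>
  Since an excess never exceeds \<open>(n - d) ln (1 / \<alpha>\<^sub>0)\<close>, the event is empty unless
  \<open>f(n) \<le> 2 (n - d) ln (1 / \<alpha>\<^sub>0)\<close>. In that case \<open>N0\<close>, the number of occurrences guaranteed for words
  of length at most \<open>d\<close>, is at least a multiple of \<open>f(n) \<alpha>\<^sub>0^d / d\<close>, which controls the probability of a
  rare word. The minimum in the exponent takes the worse of the rate for rare words and the rate for
  deviations. Taking \<open>r w\<close> as \<open>q\<close> at an arbitrary past ending in \<open>w\<close> gives the law at every context that
  is a suffix of \<open>w\<close>.
\<close>

lemma pr_overestimation:
  assumes A: "CARD('a) \<ge> 2" and a0: "alpha M X q 0 = a0" "a0 > 0"
    and est: "penalized_likelihood_estimator f d That" and f: "f n > 0" and d: "1 \<le> d n" "d n < n"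
  shows "pr n (\<lambda>xs. \<exists>v w. is_context M X q v \<and> strict_suffix v w \<and> w \<in> That xs)
    \<le> 2 * (1 + 2 * real CARD('a)) * real CARD('a) ^ d n
      * exp (- (min (1 / (8 * ln (1 / a0))) (a0 / (32 * real CARD('a))) * (f n * a0 ^ d n / real (d n))))"
    (is "pr n ?O \<le> _ * exp (- (?c * ?t))")
proof -
  define D where "D = d n"
  define m where "m = real (n - D)"
  define N0 where "N0 = m * a0 ^ D / (4 * D)"
  define W where "W = {w :: 'a list. 1 \<le> length w \<and> length w \<le> D \<and> (\<exists>v. is_context M X q v \<and> strict_suffix v w)}"
  define z where "z = sqrt (f n * a0 * N0 / (2 * real CARD('a)))"
  define r where "r w = q (SOME x. recent x (length w) = w)" for w
  have half: "a0 \<le> 1 / 2" using alpha_0_le_half[OF A] a0 by simp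
  have D: "1 \<le> D" "D < n" using d by (auto simp: D_def)
  have m: "m > 0" using D by (simp add: m_def)
  have N0: "N0 > 0" using m a0 D by (simp add: N0_def)
  have L: "ln (1 / a0) > 0" using half a0 by (simp add: ln_div)
  have finW: "finite W"
    by (rule finite_subset[OF _ finite_bounded_words[of "{w. length w \<le> D}" D]]) (auto simp: W_def)
  have r_eq: "p (Fin v) = q x" "r w = q x"
    if v: "is_context M X q v" and vw: "suffix v w" and x: "recent x (length w) = w" for v w x
  proof -
    have same: "p (Fin v) = q x'" if x': "recent x' (length w) = w" for x'
    proof -
      have "suffix v (recent x' (length w))" using x' vw by simp
      then have "recent x' (length v) = v"
        using suffix_recent_iff[of v "length w" x'] suffix_length_le[OF vw] by simp
      then show ?thesis using is_context_p_eq[OF v] by blast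
    qed
    show "p (Fin v) = q x" by (rule same[OF x])
    have "recent (SOME x. recent x (length w) = w) (length w) = w"
      by (rule someI[of "\<lambda>x. recent x (length w) = w", OF x])
    then show "r w = q x" using same same[OF x] by (metis r_def)
  qed
  let ?B0 = "\<lambda>u xs. real (count_word D xs u) \<le> N0"
  let ?B1 = "\<lambda>s u a xs. s * (count_next D xs u a - r u a * count_word D xs u) \<ge> z"
  have bad: "f n \<le> 2 * m * ln (1 / a0) \<and>
      (\<exists>u\<in>W. ?B0 u xs \<or> (\<exists>a\<in>UNIV. ?B1 1 u a xs \<or> ?B1 (- 1) u a xs))"
    if xs: "length xs = n" "?O xs" for xs
  proof -
    obtain v w where vw: "is_context M X q v" "strict_suffix v w" "w \<in> That xs" using xs(2) by blast
    have min: "is_arg_min (\<lambda>T. - ln (max_likelihood D xs T) + real (card T) * f n) (feasible D xs) (That xs)"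
      unfolding D_def using estimator_minimizes[OF est xs(1)] D by simp
    obtain u where u: "u \<in> That xs" "strict_suffix v u" "excess D xs u (p (Fin v)) \<ge> f n / 2"
      using overestimation_excess[OF A _ _ min vw(3,2,1)] a0 f by auto
    have "feasible D xs (That xs)" using min by (simp add: is_arg_min_def)
    then have uD: "length u \<le> D" using u(1) by (simp add: feasible_iff complete_code_def)
    have uW: "u \<in> W" using u uD vw(1) suffix_length_less[of v u] by (force simp: W_def)
    obtain x where x: "recent x (length u) = u" using ex_recent by blast
    have ru: "p (Fin v) = r u" "r u = q x"
      using r_eq[OF vw(1) _ x] u(2) by (auto simp: strict_suffix_def)
    have ge: "r u b \<ge> a0" for b using alpha_0_le_q a0 ru by simp
    have rs: "(\<Sum>b\<in>UNIV. r u b) = 1" using ru sum_q by simp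
    have ex: "excess D xs u (r u) \<ge> f n / 2" using u(3) ru(1) by simp
    have "f n / 2 \<le> count_word D xs u * ln (1 / a0)"
      using ex excess_le_ln[of a0 "r u" D xs u] ge a0 by simp
    also have "\<dots> \<le> m * ln (1 / a0)"
      using count_word_le[OF uD, of xs] xs L by (intro mult_right_mono) (auto simp: m_def)
    finally have fm: "f n \<le> 2 * m * ln (1 / a0)" by simp
    have "?B0 u xs \<or> (\<exists>a\<in>UNIV. ?B1 1 u a xs \<or> ?B1 (- 1) u a xs)"
    proof (cases "?B0 u xs")
      case False
      then have N: "N0 < count_word D xs u" by simp
      obtain a s where "s = 1 \<or> s = - 1" "?B1 s u a xs"
        using excess_large_imp_deviation[OF ge a0(2) rs N0 N ex f] unfolding z_def by blast
      then show ?thesis by blast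
    qed simp
    then show ?thesis using fm uW by blast
  qed
  define E where "E = exp (- (?c * ?t))"
  show ?thesis
  proof (cases "f n \<le> 2 * m * ln (1 / a0)")
    case False
    then have "pr n ?O \<le> pr n (\<lambda>xs. False)" using bad by (intro pr_mono) blast
    also have "\<dots> = 0" by (simp add: pr_def expect_def)
    finally show ?thesis by (rule order_trans) simp
  next
    case True
    have t0: "?t \<ge> 0" using f a0 by simp
    have E0: "exp (- N0) \<le> E"
    proof -
      have "?c * ?t \<le> 1 / (8 * ln (1 / a0)) * ?t" using t0 by (intro mult_right_mono) auto
      also have "\<dots> = f n / (2 * ln (1 / a0)) * (a0 ^ D / (4 * D))" by (simp add: D_def)
      also have "\<dots> \<le> m * (a0 ^ D / (4 * D))"
        using True L a0 by (intro mult_right_mono) (auto simp: divide_le_eq mult_ac)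
      also have "\<dots> = N0" by (simp add: N0_def)
      finally show ?thesis by (simp add: E_def)
    qed
    have E1: "exp (- (z\<^sup>2 / (4 * m))) \<le> E"
    proof -
      have "?c * ?t \<le> a0 / (32 * real CARD('a)) * ?t" using t0 by (intro mult_right_mono) auto
      also have "\<dots> = z\<^sup>2 / (4 * m)"
        using f a0 N0 m D by (simp add: z_def N0_def D_def[symmetric] field_simps)
      finally show ?thesis by (simp add: E_def)
    qed
    have p0: "pr n (?B0 u) \<le> E" if u: "u \<in> W" for u
    proof -
      define l where "l = length u"
      have l: "1 \<le> l" "l \<le> D" using u by (auto simp: W_def l_def)
      have "a0 ^ D / (4 * D) \<le> a0 ^ l / (4 * l)"
        using l a0 half by (intro frac_le power_decreasing) auto
      then have "m * (a0 ^ D / (4 * D)) \<le> m * (a0 ^ l / (4 * l))"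
        using m by (intro mult_left_mono) auto
      then have NN: "N0 \<le> m * a0 ^ l / (4 * l)" by (simp add: N0_def)
      have "pr n (?B0 u) \<le> pr n (\<lambda>xs. count_word D xs u \<le> real (n - D) * a0 ^ l / (4 * l))"
        by (rule pr_mono) (use NN m_def in auto)
      also have "\<dots> \<le> exp (- (real (n - D) * a0 ^ l / (4 * l)))"
        using pr_count_word_small[OF word_prob_snoc_ge, of u l D n] a0 half l D by (simp add: l_def)
      also have "\<dots> \<le> exp (- N0)" using NN by (simp add: m_def)
      finally show ?thesis using E0 by simp
    qed
    have p1: "pr n (?B1 s u a) \<le> E" if u: "u \<in> W" and s: "s = 1 \<or> s = - 1" for s u a
    proof -
      obtain v where v: "is_context M X q v" "suffix v u" using u by (auto simp: W_def strict_suffix_def)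
      have rb: "0 \<le> r u a" "r u a \<le> 1" by (simp_all add: r_def q_nonneg q_le_1)
      have "pr n (?B1 s u a) \<le> exp (- (z\<^sup>2 / (4 * real (n - D))))"
      proof (rule pr_deviation[OF _ D(2) s _ rb])
        show "length u \<le> D" using u by (simp add: W_def)
        show "0 \<le> z" using f a0 N0 by (simp add: z_def)
        fix xs assume xs: "suffix u xs"
        have "q x a = r u a" if x: "recent x (length xs) = xs" for x
        proof -
          have "suffix u (recent x (length xs))" using xs x by simp
          then have "recent x (length u) = u"
            using suffix_recent_iff[of u "length xs" x] suffix_length_le[OF xs] by simp
          then show ?thesis using r_eq(2)[OF v] by simp
        qed
        then have "word_prob M X (xs @ [a]) = r u a * word_prob M X xs"
          using word_prob_snoc_bounds[of xs "r u a" a "r u a"] by (simp add: antisym)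
        then show "s * word_prob M X (xs @ [a]) \<le> s * (r u a * word_prob M X xs)" by simp
      qed
      then show ?thesis using E1 by (simp add: m_def)
    qed
    have pu: "pr n (\<lambda>xs. ?B0 u xs \<or> (\<exists>a\<in>UNIV. ?B1 1 u a xs \<or> ?B1 (- 1) u a xs)) \<le> (1 + 2 * real CARD('a)) * E"
      if u: "u \<in> W" for u
    proof -
      have "pr n (\<lambda>xs. ?B1 1 u a xs \<or> ?B1 (- 1) u a xs) \<le> 2 * E" for a
        using pr_disj_le[of n "?B1 1 u a" "?B1 (- 1) u a"] p1[OF u, of 1 a] p1[OF u, of "- 1" a] by linarith
      then have "(\<Sum>a\<in>UNIV. pr n (\<lambda>xs. ?B1 1 u a xs \<or> ?B1 (- 1) u a xs)) \<le> (\<Sum>a\<in>(UNIV::'a set). 2 * E)"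
        by (rule sum_mono)
      then have "pr n (\<lambda>xs. \<exists>a\<in>UNIV. ?B1 1 u a xs \<or> ?B1 (- 1) u a xs) \<le> real CARD('a) * (2 * E)"
        using pr_bex_le[of UNIV n "\<lambda>a xs. ?B1 1 u a xs \<or> ?B1 (- 1) u a xs"] by simp
      then have "pr n (?B0 u) + pr n (\<lambda>xs. \<exists>a\<in>UNIV. ?B1 1 u a xs \<or> ?B1 (- 1) u a xs) \<le> (1 + 2 * real CARD('a)) * E"
        using p0[OF u] by (simp add: algebra_simps)
      with pr_disj_le show ?thesis by (rule order_trans)
    qed
    have "pr n ?O \<le> pr n (\<lambda>xs. \<exists>u\<in>W. ?B0 u xs \<or> (\<exists>a\<in>UNIV. ?B1 1 u a xs \<or> ?B1 (- 1) u a xs))"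
      by (rule pr_mono) (use bad in blast)
    also have "\<dots> \<le> (\<Sum>u\<in>W. pr n (\<lambda>xs. ?B0 u xs \<or> (\<exists>a\<in>UNIV. ?B1 1 u a xs \<or> ?B1 (- 1) u a xs)))"
      by (rule pr_bex_le[OF finW])
    also have "\<dots> \<le> (\<Sum>u\<in>W. (1 + 2 * real CARD('a)) * E)"
      by (rule sum_mono[OF pu])
    also have "\<dots> = real (card W) * ((1 + 2 * real CARD('a)) * E)" by simp
    also have "\<dots> \<le> real (2 * CARD('a) ^ D) * ((1 + 2 * real CARD('a)) * E)"
    proof (intro mult_right_mono of_nat_mono)
      have "card W \<le> card {w :: 'a list. length w \<le> D}"
        by (rule card_mono[OF finite_bounded_words]) (auto simp: W_def)
      then show "card W \<le> 2 * CARD('a) ^ D" using card_bounded_words_le[OF A, of D] by linarith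
    qed (simp add: E_def)
    also have "\<dots> = 2 * (1 + 2 * real CARD('a)) * real CARD('a) ^ D * E" by (simp add: algebra_simps)
    finally show ?thesis unfolding E_def D_def .
  qed
qed

end

theorem theorem2p11:
  fixes M :: "'b measure"
    and X :: "int \<Rightarrow> 'b \<Rightarrow> 'a::finite"
    and q :: "(nat \<Rightarrow> 'a) \<Rightarrow> 'a \<Rightarrow> real"
    and K :: nat
  assumes "CARD('a) \<ge> 2"
    and "stationary_ergodic_process M X"
    and "past_version M X q"
    and "alpha M X q 0 > 0"
    and "summable (\<lambda>k. 1 - alpha M X q k)"
  shows "\<exists>c1 c2 c3 c4 :: real. c1 > 0 \<and> c2 > 0 \<and> c3 > 0 \<and> c4 > 0 \<and>
    (\<forall>(f :: nat \<Rightarrow> real) (d :: nat \<Rightarrow> nat) (That :: 'a list \<Rightarrow> 'a list set).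
       penalizing_term f \<longrightarrow> (\<forall>n\<ge>1. d n < n) \<longrightarrow> filterlim d at_top sequentially \<longrightarrow>
       penalized_likelihood_estimator f d That \<longrightarrow>
       (\<exists>n0. \<forall>n\<ge>n0.
          ((\<lambda>m. f m / (real m - real (d m))) \<longlonglongrightarrow> 0 \<longrightarrow>
             measure M (underestimation M X q That K n) \<le> c1 * exp (- c2 * (real n - real (d n)))) \<and>
          measure M (overestimation M X q That K n) \<le>
            c3 * real CARD('a) ^ d n *
            exp (- c4 * f n * ((alpha M X q 0)\<^sup>2 / real CARD('a)) ^ d n / real (d n))))"
proof -
  interpret process M X q
    by standard (use assms in auto)
  define a0 where "a0 = alpha M X q 0"
  have a0: "0 < a0" "a0 \<le> 1 / 2" using assms(4) alpha_0_le_half[OF assms(1)] by (auto simp: a0_def)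
  have cont: "(\<lambda>k. \<bar>1 - alpha M X q k\<bar>) \<longlonglongrightarrow> 0"
    using summable_LIMSEQ_zero[OF assms(5)] by (simp add: tendsto_rabs_zero)
  define W where "W = {w. Fin w \<in> Int_tree (truncation T0 K)}"
  have finW: "finite W"
    by (rule finite_bounded_words[of _ K]) (auto simp: W_def intro: less_imp_le Int_truncation_not_determined)
  \<comment> \<open>the constants of the underestimation bound depend on the internal node \<open>w\<close>; there are finitely
    many such nodes, so their bounds can be added up\<close>
  define G where "G w c1 c2 \<longleftrightarrow> c1 > 0 \<and> c2 > 0 \<and> (\<forall>(f :: nat \<Rightarrow> real) (d :: nat \<Rightarrow> nat) That.
    penalizing_term f \<longrightarrow> (\<forall>n\<ge>1. d n < n) \<longrightarrow> filterlim d at_top sequentially \<longrightarrow>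
    penalized_likelihood_estimator f d That \<longrightarrow> (\<lambda>m. f m / (real m - real (d m))) \<longlonglongrightarrow> 0 \<longrightarrow>
    (\<forall>\<^sub>F n in sequentially. pr n (\<lambda>xs. w \<in> That xs) \<le> c1 * exp (- c2 * (real n - real (d n)))))"
    for w and c1 c2 :: real
  have "\<exists>c1 c2. G w c1 c2" if "w \<in> W" for w
  proof -
    have "\<not> determines_next M X q w" using that Int_truncation_not_determined by (simp add: W_def)
    from q_varies[OF word_prob_pos[OF assms(4)] this] obtain x y a
      where "recent x (length w) = w" "recent y (length w) = w" "q x a < q y a" .
    from pr_internal_node_selected[OF assms(4) cont this] show ?thesis unfolding G_def .
  qed
  then obtain C1 C2 where C: "\<And>w. w \<in> W \<Longrightarrow> G w (C1 w) (C2 w)" by metis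
  define c1 where "c1 = 1 + (\<Sum>w\<in>W. C1 w)"
  define c2 where "c2 = Min (insert 1 (C2 ` W))"
  define c3 where "c3 = 2 * (1 + 2 * real CARD('a))"
  define c4 where "c4 = min (1 / (8 * ln (1 / a0))) (a0 / (32 * real CARD('a)))"
  have "(\<Sum>w\<in>W. C1 w) \<ge> 0" using C by (intro sum_nonneg) (auto simp: G_def less_imp_le)
  then have c1: "c1 > 0" by (simp add: c1_def)
  have c2: "c2 > 0" unfolding c2_def using finW C by (subst Min_gr_iff) (auto simp: G_def)
  have c3: "c3 > 0" by (simp add: c3_def)
  have "ln (1 / a0) > 0" using a0 by (simp add: ln_div)
  then have c4: "c4 > 0" using a0 by (simp add: c4_def)
  have main: "\<exists>n0. \<forall>n\<ge>n0.
      ((\<lambda>m. f m / (real m - real (d m))) \<longlonglongrightarrow> 0 \<longrightarrow>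
         prob (underestimation M X q That K n) \<le> c1 * exp (- c2 * (real n - real (d n)))) \<and>
      prob (overestimation M X q That K n) \<le>
        c3 * real CARD('a) ^ d n * exp (- c4 * f n * ((alpha M X q 0)\<^sup>2 / real CARD('a)) ^ d n / real (d n))"
    if f: "penalizing_term f" and dn: "\<forall>n\<ge>1. d n < n" and d: "filterlim d at_top sequentially"
      and est: "penalized_likelihood_estimator f d That"
    for f :: "nat \<Rightarrow> real" and d :: "nat \<Rightarrow> nat" and That :: "'a list \<Rightarrow> 'a list set"
  proof -
    have under: "\<forall>\<^sub>F n in sequentially. (\<lambda>m. f m / (real m - real (d m))) \<longlonglongrightarrow> 0 \<longrightarrow>
        prob (underestimation M X q That K n) \<le> c1 * exp (- c2 * (real n - real (d n)))"
    proof (cases "(\<lambda>m. f m / (real m - real (d m))) \<longlonglongrightarrow> 0")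
      case True
      have "\<forall>\<^sub>F n in sequentially. \<forall>w\<in>W. pr n (\<lambda>xs. w \<in> That xs) \<le> C1 w * exp (- C2 w * (real n - real (d n)))"
        using C f dn d est True by (intro eventually_ball_finite[OF finW]) (auto simp: G_def)
      moreover have "\<forall>\<^sub>F n in sequentially. (1::nat) \<le> n" by (rule eventually_ge_at_top)
      ultimately show ?thesis
      proof eventually_elim
        case (elim n)
        have m: "real n - real (d n) \<ge> 0" using dn elim by (simp add: less_imp_le)
        have "underestimation M X q That K n = {\<omega>\<in>space M. \<exists>w\<in>W. w \<in> That (block X 1 (int n) \<omega>)}"
          by (auto simp: underestimation_def W_def)
        then have "prob (underestimation M X q That K n) = pr n (\<lambda>xs. \<exists>w\<in>W. w \<in> That xs)"
          using prob_sample[of "\<lambda>xs. \<exists>w\<in>W. w \<in> That xs" n] by simp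
        also have "\<dots> \<le> (\<Sum>w\<in>W. pr n (\<lambda>xs. w \<in> That xs))" by (rule pr_bex_le[OF finW])
        also have "\<dots> \<le> (\<Sum>w\<in>W. C1 w * exp (- c2 * (real n - real (d n))))"
        proof (rule sum_mono)
          fix w assume w: "w \<in> W"
          have "c2 \<le> C2 w" unfolding c2_def using w finW by (intro Min_le) auto
          then have "exp (- C2 w * (real n - real (d n))) \<le> exp (- c2 * (real n - real (d n)))"
            using m by (simp add: mult_right_mono)
          then have "C1 w * exp (- C2 w * (real n - real (d n))) \<le> C1 w * exp (- c2 * (real n - real (d n)))"
            using C[OF w] by (intro mult_left_mono) (auto simp: G_def)
          then show "pr n (\<lambda>xs. w \<in> That xs) \<le> C1 w * exp (- c2 * (real n - real (d n)))"
            using elim(1) w by (meson order_trans)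
        qed
        also have "\<dots> = (\<Sum>w\<in>W. C1 w) * exp (- c2 * (real n - real (d n)))"
          by (simp add: sum_distrib_right)
        also have "\<dots> \<le> c1 * exp (- c2 * (real n - real (d n)))"
          by (intro mult_right_mono) (auto simp: c1_def)
        finally show ?case by simp
      qed
    qed simp
    have "\<forall>\<^sub>F n in sequentially. (1::nat) \<le> d n" using d by (simp add: filterlim_at_top)
    moreover have "\<forall>\<^sub>F n in sequentially. (1::nat) \<le> n" by (rule eventually_ge_at_top)
    ultimately have over: "\<forall>\<^sub>F n in sequentially. prob (overestimation M X q That K n) \<le>
        c3 * real CARD('a) ^ d n * exp (- c4 * f n * ((alpha M X q 0)\<^sup>2 / real CARD('a)) ^ d n / real (d n))"
    proof eventually_elim
      case (elim n)
      have f0: "f n > 0" using f by (simp add: penalizing_term_def)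
      let ?O = "\<lambda>xs. \<exists>w. (\<exists>v\<in>T0. proper_suffix v (Fin w) \<and> len v < enat K) \<and> w \<in> That xs"
      have O: "\<exists>v w. is_context M X q v \<and> strict_suffix v w \<and> w \<in> That xs" if O: "?O xs" for xs
      proof -
        obtain w v where vw: "v \<in> T0" "proper_suffix v (Fin w)" "w \<in> That xs" using O by blast
        then obtain v' where "v = Fin v'" by (cases v) auto
        then show ?thesis using vw by (auto simp: context_tree_def)
      qed
      have "overestimation M X q That K n = {\<omega>\<in>space M. ?O (block X 1 (int n) \<omega>)}"
        by (auto simp: overestimation_def)
      then have "prob (overestimation M X q That K n) = pr n ?O"
        using prob_sample[of ?O n] by simp
      also have "\<dots> \<le> pr n (\<lambda>xs. \<exists>v w. is_context M X q v \<and> strict_suffix v w \<and> w \<in> That xs)"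
        by (rule pr_mono) (rule O)
      also have "\<dots> \<le> c3 * real CARD('a) ^ d n * exp (- (c4 * (f n * a0 ^ d n / real (d n))))"
        unfolding c3_def c4_def
        by (rule pr_overestimation[OF assms(1) a0_def[symmetric] a0(1) est f0 elim(1)]) (use dn elim in simp)
      also have "\<dots> \<le> c3 * real CARD('a) ^ d n * exp (- c4 * f n * ((alpha M X q 0)\<^sup>2 / real CARD('a)) ^ d n / real (d n))"
      proof (rule mult_left_mono)
        \<comment> \<open>the bound obtained, with \<open>\<alpha>\<^sub>0 ^ d\<close> in the exponent, is stronger than the one claimed\<close>
        have "a0\<^sup>2 / real CARD('a) \<le> a0"
          using a0 assms(1) by (simp add: power2_eq_square divide_le_eq mult_left_mono)
        then have "(a0\<^sup>2 / real CARD('a)) ^ d n \<le> a0 ^ d n" by (intro power_mono) auto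
        then have "c4 * (f n * (a0\<^sup>2 / real CARD('a)) ^ d n / real (d n)) \<le> c4 * (f n * a0 ^ d n / real (d n))"
          using c4 f0 by (intro mult_left_mono divide_right_mono) auto
        then show "exp (- (c4 * (f n * a0 ^ d n / real (d n))))
            \<le> exp (- c4 * f n * ((alpha M X q 0)\<^sup>2 / real CARD('a)) ^ d n / real (d n))"
          by (simp add: a0_def mult_ac)
      qed (use c3 in simp)
      finally show ?case .
    qed
    from eventually_conj[OF under over] show ?thesis unfolding eventually_sequentially .
  qed
  show ?thesis
    by (rule exI[of _ c1], rule exI[of _ c2], rule exI[of _ c3], rule exI[of _ c4])
      (intro conjI c1 c2 c3 c4, intro allI impI, rule main)
qed

end
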